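(* Let $0<p\le 1$. Suppose that the initial weights of the cells of the chain $\mathbb{Z}$ are independent random variables $\zeta_j$, $j\in\mathbb{Z}$, with $\zeta_j=1$ with probability $p$ and $\zeta_j=0$ with probability $1-p$. Then the densities $\rho_i$ of cells with weight $i$ after $N$ steps of compression have the form $$\rho_i=F^{(i)}(1-p)\,\frac{p^i}{i!},\qquad i\ge0,$$ where $$F(z)=\frac{z(z^{2^N}-1)^2}{4^N(z-1)^2}\quad\text{for ordered stochastic compression},$$ $$F(z)=\underbrace{P\circ\cdots\circ P}_{N}(z),\quad P(z)=\tfrac14(z+2z^2+z^3),\quad\text{for disordered stochastic compression}.$$ Moreover, for every $i\ge0$, the limits of relative densities are $$\lim_{N\to\infty}\frac{\rho_i}{\rho_1}=\frac{i+1-p}{2-p}\quad\text{in the ordered case},$$ $$\lim_{N\to\infty}\frac{\rho_i}{\rho_1}=\frac{\Phi^{(i)}(1-p)\,p^{i-1}}{\Phi'(1-p)\,i!}\quad\text{in the disordered case},$$ where $\Phi(z)=\lim_{N\to\infty}4^N\underbrace{P\circ\cdots\circ P}_{N}(z)$.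
   Context: State of the chain: a family $(x_j)_{j\in\mathbb{Z}}$ of nonnegative integer weights (weight $0$ is allowed; such cells are called empty, but they take part in the compression as any other cell). The density of cells with weight $i$ is $$\rho_i=\lim_{L\to\infty}\frac1{2L}\#\{j\in\{-L,\dots,L-1\}:\ x_j=i\}$$ (an almost sure limit, since the states are random). One merging step: every even cell $2j$ independently, with probability $1/2$ each, moves left or right (independently of the current state and of the past), and its weight is added to the weight of the odd cell $2j-1$ or $2j+1$ respectively. Thus the odd cell $2j+1$ receives the new weight $$y_j=x_{2j+1}+\mathbf 1[\text{cell }2j\text{ moves right}]\,x_{2j}+\mathbf 1[\text{cell }2j+2\text{ moves left}]\,x_{2j+2}.$$ The odd cells then fill the places vacated by the even cells, compressing the chain twice. Ordered stochastic compression (OSC): the odd cells are only shifted, preserving order, so the new state is $(y_j)_{j\in\mathbb{Z}}$. Disordered stochastic compression (DSC): the odd cells fill the vacated places in random order (random permutations). This is understood in the sense that after each step the weights of the cells in the chain are independent and identically distributed, the common law being the law of a single merged cell $y_j$; that is, after each DSC step the new state is an i.i.d. family with the one-cell distribution of $y_0$, and the next merging step is applied to this i.i.d. family. The function $\Phi$ is analytic on the basin of attraction of the fixed point $0$ of $P$ (note $P(0)=0$, $P'(0)=\frac14$), which contains the open unit disc and hence $[0,1)$; it satisfies $\Phi(P(z))=\frac14\Phi(z)$, $\Phi'(0)=1$. *)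

theory Defs
  imports "HOL-Probability.Probability"
begin

definition empirical_density :: "(int \<Rightarrow> nat) \<Rightarrow> nat \<Rightarrow> nat \<Rightarrow> real" where
  "empirical_density x i L = real (card {j \<in> {- int L..<int L}. x j = i}) / (2 * real L)"

definition has_cell_density :: "(int \<Rightarrow> nat) \<Rightarrow> nat \<Rightarrow> real \<Rightarrow> bool" where
  "has_cell_density x i d \<longleftrightarrow> empirical_density x i \<longlonglongrightarrow> d"

definition cell_density :: "(int \<Rightarrow> nat) \<Rightarrow> nat \<Rightarrow> real" where
  "cell_density x i = lim (empirical_density x i)"

text \<open>In one merging step, \<open>r j\<close> says that the even cell \<open>2 * j\<close> moves right; otherwise it
  moves left. Entry \<open>j\<close> of the result is the new weight of the odd cell \<open>2 * j + 1\<close>.\<close>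

definition merge :: "(int \<Rightarrow> bool) \<Rightarrow> (int \<Rightarrow> nat) \<Rightarrow> int \<Rightarrow> nat" where
  "merge r x j = x (2 * j + 1) + (if r j then x (2 * j) else 0)
                               + (if \<not> r (j + 1) then x (2 * j + 2) else 0)"

text \<open>Below, a random chain is a sequence \<open>x\<close> of random states together with a sequence \<open>r\<close> of
  random moves on a probability space \<open>M\<close>: \<open>x n j \<omega>\<close> is the weight of cell \<open>j\<close> after \<open>n\<close>
  compression steps, and \<open>r n\<close> contains the moves that lead from step \<open>n\<close> to step \<open>n + 1\<close>.\<close>

definition bernoulli_weights :: "'a measure \<Rightarrow> real \<Rightarrow> (int \<Rightarrow> 'a \<Rightarrow> nat) \<Rightarrow> bool" where
  "bernoulli_weights M p \<zeta> \<longleftrightarrow>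
     prob_space.indep_vars M (\<lambda>_. count_space UNIV) \<zeta> UNIV \<and>
     (\<forall>j. measure M {\<omega> \<in> space M. \<zeta> j \<omega> = 1} = p \<and>
          measure M {\<omega> \<in> space M. \<zeta> j \<omega> = 0} = 1 - p)"

definition generators :: "'a measure \<Rightarrow> ('i \<Rightarrow> 'a \<Rightarrow> 'b) \<Rightarrow> 'a set set" where
  "generators M X = {X i -` A \<inter> space M | i A. True}"

definition past_events ::
  "'a measure \<Rightarrow> (nat \<Rightarrow> int \<Rightarrow> 'a \<Rightarrow> nat) \<Rightarrow> (nat \<Rightarrow> int \<Rightarrow> 'a \<Rightarrow> bool) \<Rightarrow> nat \<Rightarrow> 'a set set" where
  "past_events M x r n = sigma_sets (space M)
     ((\<Union>k\<in>{..n}. generators M (x k)) \<union> (\<Union>k\<in>{..<n}. generators M (r k)))"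

definition fair_moves ::
  "'a measure \<Rightarrow> (nat \<Rightarrow> int \<Rightarrow> 'a \<Rightarrow> nat) \<Rightarrow> (nat \<Rightarrow> int \<Rightarrow> 'a \<Rightarrow> bool) \<Rightarrow> bool" where
  "fair_moves M x r \<longleftrightarrow> (\<forall>n.
     prob_space.indep_vars M (\<lambda>_. count_space UNIV) (r n) UNIV \<and>
     (\<forall>j. measure M {\<omega> \<in> space M. r n j \<omega>} = 1 / 2) \<and>
     prob_space.indep_set M (sigma_sets (space M) (generators M (r n))) (past_events M x r n))"

definition ordered_compression ::
  "'a measure \<Rightarrow> (nat \<Rightarrow> int \<Rightarrow> 'a \<Rightarrow> nat) \<Rightarrow> (nat \<Rightarrow> int \<Rightarrow> 'a \<Rightarrow> bool) \<Rightarrow> bool" where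
  "ordered_compression M x r \<longleftrightarrow>
     (\<forall>n j. \<forall>\<omega>\<in>space M. x (Suc n) j \<omega> = merge (\<lambda>k. r n k \<omega>) (\<lambda>k. x n k \<omega>) j)"

text \<open>The random permutation of the merged cells is not modelled itself: the state after a
  disordered step is any i.i.d. family whose one-cell law is that of a merged cell.\<close>

definition disordered_compression ::
  "'a measure \<Rightarrow> (nat \<Rightarrow> int \<Rightarrow> 'a \<Rightarrow> nat) \<Rightarrow> (nat \<Rightarrow> int \<Rightarrow> 'a \<Rightarrow> bool) \<Rightarrow> bool" where
  "disordered_compression M x r \<longleftrightarrow> (\<forall>n.
     prob_space.indep_vars M (\<lambda>_. count_space UNIV) (x (Suc n)) UNIV \<and>
     (\<forall>j. distr M (count_space UNIV) (x (Suc n) j) =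
          distr M (count_space UNIV) (\<lambda>\<omega>. merge (\<lambda>k. r n k \<omega>) (\<lambda>k. x n k \<omega>) 0)))"

definition F_ordered :: "nat \<Rightarrow> real \<Rightarrow> real" where
  "F_ordered N z = z * (z ^ (2 ^ N) - 1)\<^sup>2 / (4 ^ N * (z - 1)\<^sup>2)"

definition P :: "'a::field \<Rightarrow> 'a" where
  "P z = 1 / 4 * (z + 2 * z\<^sup>2 + z ^ 3)"

definition F_disordered :: "nat \<Rightarrow> real \<Rightarrow> real" where
  "F_disordered N = P ^^ N"

text \<open>The limit exists on the basin of attraction of the fixed point \<open>0\<close> of \<open>P\<close>, which contains the
  open unit disc; elsewhere \<open>Phi\<close> carries no meaning.\<close>

definition Phi :: "complex \<Rightarrow> complex" where
  "Phi z = lim (\<lambda>N. 4 ^ N * (P ^^ N) z)"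

end

theory Submission
  imports Defs "HOL-Complex_Analysis.Complex_Analysis" "HOL-Library.Discrete_Functions"
begin

text \<open>In the ordered case the weight of cell \<open>j\<close> after \<open>N\<close> steps is the sum of the initial weights
  over a block of consecutive cells whose random left end is read off the moves: it is uniform on the
  window \<open>2 ^ N * j, \<dots>, 2 ^ N * (j + 1) - 1\<close>, and the ends belonging to different windows are
  independent. So the block length has generating function \<open>z * (\<Sum>k<2 ^ N. z ^ k)\<^sup>2 / 4 ^ N\<close>, which is
  \<open>F\<close>, and the weight has generating function \<open>F (1 - p + p * z)\<close>; weights at distance at least \<open>2\<close>
  are independent. In the disordered case one step replaces the generating function \<open>g\<close> by
  \<open>P \<circ> g\<close>. In both cases a second moment bound along the squares gives the law of large
  numbers, and Taylor's formula at \<open>1 - p\<close> turns the coefficients into derivatives of \<open>F\<close>.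
  The functions \<open>4 ^ N * F\<close> converge locally uniformly on the unit disc, to \<open>z / (1 - z)\<^sup>2\<close> and
  \<open>\<Phi>\<close> respectively, so their derivatives converge as well.\<close>

subsection \<open>Generating polynomials and their derivatives\<close>

text \<open>Taylor's formula: differentiating \<open>i\<close> times pulls out \<open>b ^ i\<close>,
  and the constant coefficient of an \<open>i\<close>-th derivative is \<open>fact i\<close> times
  the coefficient of index \<open>i\<close>. With \<open>a = 1 - p\<close> and \<open>b = p\<close>
  this yields the form of the densities.\<close>

lemma coeff_pcompose_affine:
  fixes Q :: "'a::field_char_0 poly"
  shows "coeff (Q \<circ>\<^sub>p [:a, b:]) i = poly ((pderiv ^^ i) Q) a * b ^ i / fact i"
proof -
  have "(pderiv ^^ i) (Q \<circ>\<^sub>p [:a, b:]) = smult (b ^ i) ((pderiv ^^ i) Q \<circ>\<^sub>p [:a, b:])"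
    by (induction i) (simp_all add: pderiv_smult pderiv_pcompose pderiv_pCons mult.commute)
  then have "coeff ((pderiv ^^ i) (Q \<circ>\<^sub>p [:a, b:])) 0 = b ^ i * poly ((pderiv ^^ i) Q) a"
    by (simp flip: poly_0_coeff_0 add: poly_pcompose)
  then show ?thesis
    by (simp add: coeff_higher_pderiv pochhammer_fact[symmetric] field_simps)
qed

lemma higher_deriv_poly:
  fixes q :: "'a::real_normed_field poly"
  shows "(deriv ^^ n) (poly q) = poly ((pderiv ^^ n) q)"
proof -
  have "deriv (poly q) = poly (pderiv q)" for q :: "'a poly"
    by (rule ext) (simp add: DERIV_imp_deriv poly_DERIV)
  then show ?thesis
    by (induction n) simp_all
qed

text \<open>Polynomials are moved to the complex plane because locally uniform convergence there
  carries over to all derivatives, which fails on the real line.\<close>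

abbreviation cpoly :: "real poly \<Rightarrow> complex poly" where
  "cpoly \<equiv> map_poly complex_of_real"

lemma cpoly_add: "cpoly (p + q) = cpoly p + cpoly q"
  by (rule poly_eqI) (simp add: coeff_map_poly)

lemma cpoly_smult: "cpoly (smult c q) = smult (of_real c) (cpoly q)"
  by (rule poly_eqI) (simp add: coeff_map_poly)

lemma cpoly_mult: "cpoly (p * q) = cpoly p * cpoly q"
  by (rule poly_eqI) (simp add: coeff_map_poly coeff_mult)

lemma cpoly_power: "cpoly (q ^ n) = cpoly q ^ n"
  by (induction n) (simp_all add: cpoly_mult)

lemma cpoly_sum: "cpoly (sum f A) = (\<Sum>x\<in>A. cpoly (f x))"
  by (induction A rule: infinite_finite_induct) (simp_all add: cpoly_add)

lemma cpoly_higher_pderiv: "(pderiv ^^ n) (cpoly q) = cpoly ((pderiv ^^ n) q)"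
proof -
  have "pderiv (cpoly q) = cpoly (pderiv q)" for q
    by (rule poly_eqI) (simp add: coeff_map_poly coeff_pderiv)
  then show ?thesis
    by (induction n) simp_all
qed

lemma poly_cpoly_of_real: "poly (cpoly q) (of_real x) = of_real (poly q x)"
  by (induction q) (simp_all add: map_poly_pCons)

text \<open>Weierstrass' theorem on derivatives, applied on a disc whose radius lies strictly
  between the modulus of \<open>a\<close> and \<open>1\<close>.\<close>

lemma tendsto_higher_pderiv:
  fixes Q :: "nat \<Rightarrow> real poly" and G :: "complex \<Rightarrow> complex"
  assumes unif: "\<And>s. 0 < s \<Longrightarrow> s < 1 \<Longrightarrow> uniform_limit (cball 0 s) (\<lambda>N. poly (cpoly (Q N))) G sequentially"
    and "\<bar>a\<bar> < 1"
  shows "(\<lambda>N. complex_of_real (poly ((pderiv ^^ i) (Q N)) a)) \<longlonglongrightarrow> (deriv ^^ i) G (of_real a)"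
proof -
  obtain s where s: "\<bar>a\<bar> < s" "s < 1"
    using dense[OF \<open>\<bar>a\<bar> < 1\<close>] by blast
  have "(\<lambda>N. (deriv ^^ i) (poly (cpoly (Q N))) (of_real a)) \<longlonglongrightarrow> (deriv ^^ i) G (of_real a)"
  proof (rule higher_deriv_complex_uniform_limit)
    show "uniform_limit (ball 0 s) (\<lambda>N. poly (cpoly (Q N))) G sequentially"
      by (rule uniform_limit_on_subset[OF unif]) (use s in auto)
  qed (use s in \<open>auto intro!: always_eventually holomorphic_intros\<close>)
  then show ?thesis
    by (simp add: higher_deriv_poly cpoly_higher_pderiv poly_cpoly_of_real)
qed

text \<open>The normalisation \<open>4 ^ N\<close> cancels in the quotient, so ratios of
  coefficients follow the derivatives of \<open>G\<close>. The exponent of \<open>powi\<close> is an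
  integer because \<open>i = 0\<close> leaves the factor \<open>1 / p\<close>.\<close>

lemma tendsto_relative_coeff:
  fixes F :: "nat \<Rightarrow> real poly" and G :: "complex \<Rightarrow> complex"
  assumes unif: "\<And>s. 0 < s \<Longrightarrow> s < 1 \<Longrightarrow>
      uniform_limit (cball 0 s) (\<lambda>N. poly (cpoly (smult (4 ^ N) (F N)))) G sequentially"
    and "0 < p" "p \<le> 1" and nz: "deriv G (of_real (1 - p)) \<noteq> 0"
  shows "(\<lambda>N. complex_of_real (coeff (F N \<circ>\<^sub>p [:1 - p, p:]) i / coeff (F N \<circ>\<^sub>p [:1 - p, p:]) 1))
    \<longlonglongrightarrow> (deriv ^^ i) G (of_real (1 - p)) * of_real (p powi (int i - 1))
          / (deriv G (of_real (1 - p)) * fact i)"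
proof -
  define c where "c i N = poly ((pderiv ^^ i) (smult (4 ^ N) (F N))) (1 - p)" for i N
  have lim: "(\<lambda>N. complex_of_real (c i N)) \<longlonglongrightarrow> (deriv ^^ i) G (of_real (1 - p))" for i
    unfolding c_def by (rule tendsto_higher_pderiv[OF unif]) (use assms in auto)
  have "(\<lambda>N. complex_of_real (c i N) * of_real (p powi (int i - 1)) / (of_real (c 1 N) * fact i)) 
    \<longlonglongrightarrow> (deriv ^^ i) G (of_real (1 - p)) * of_real (p powi (int i - 1))
          / (deriv G (of_real (1 - p)) * fact i)"
    using lim[of 1] nz by (intro tendsto_intros lim) auto
  moreover have "complex_of_real (c i N) * of_real (p powi (int i - 1)) / (of_real (c 1 N) * fact i)
      = complex_of_real (coeff (F N \<circ>\<^sub>p [:1 - p, p:]) i / coeff (F N \<circ>\<^sub>p [:1 - p, p:]) 1)" for N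
    using \<open>0 < p\<close>
    by (simp add: c_def coeff_pcompose_affine higher_pderiv_smult pderiv_smult power_int_diff field_simps)
  ultimately show ?thesis
    by simp
qed

section \<open>Scaled limits of the two families of generating polynomials\<close>

text \<open>The geometric sum replaces the quotient in \<open>F_ordered\<close> and so removes the
  singularity at \<open>1\<close>, where \<open>F_ordered\<close> takes the default value
  \<open>0\<close>.\<close>

definition ordered_poly :: "nat \<Rightarrow> real poly" where
  "ordered_poly N = smult (1 / 4 ^ N) ([:0, 1:] * (\<Sum>k<2 ^ N. [:0, 1:] ^ k)\<^sup>2)"

text \<open>The formula of \<open>P\<close> is repeated on polynomials, since \<open>P\<close>
  itself is declared on fields only.\<close>

definition disordered_poly :: "nat \<Rightarrow> real poly" where
  "disordered_poly N = ((\<lambda>q. smult (1 / 4) (q + smult 2 (q\<^sup>2) + q ^ 3)) ^^ N) [:0, 1:]"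

lemma F_disordered_eq_poly: "F_disordered N = poly (disordered_poly N)"
proof (rule ext)
  show "F_disordered N z = poly (disordered_poly N) z" for z
    by (induction N) (simp_all add: F_disordered_def disordered_poly_def P_def)
qed

lemma poly_cpoly_disordered: "poly (cpoly (disordered_poly N)) z = (P ^^ N) z"
  by (induction N)
    (simp_all add: disordered_poly_def P_def cpoly_add cpoly_smult cpoly_power map_poly_pCons)

lemma F_ordered_eq_poly: "z \<noteq> 1 \<Longrightarrow> F_ordered N z = poly (ordered_poly N) z"
  by (simp add: F_ordered_def ordered_poly_def poly_sum geometric_sum power_divide divide_simps)

lemma poly_cpoly_ordered:
  assumes "z \<noteq> 1"
  shows "poly (cpoly (smult (4 ^ N) (ordered_poly N))) z = z * (z ^ (2 ^ N) - 1)\<^sup>2 / (z - 1)\<^sup>2"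
  using assms
  by (simp add: ordered_poly_def cpoly_smult cpoly_mult cpoly_power cpoly_sum map_poly_pCons
      poly_sum geometric_sum power_divide)

text \<open>The two functions agree only off \<open>1\<close>, but derivatives at \<open>z\<close>
  depend only on values near \<open>z\<close>.\<close>

lemma higher_deriv_F_ordered:
  assumes "z \<noteq> 1"
  shows "(deriv ^^ i) (F_ordered N) z = poly ((pderiv ^^ i) (ordered_poly N)) z"
proof -
  have "\<forall>\<^sub>F w in nhds z. F_ordered N w = poly (ordered_poly N) w"
    using t1_space_nhds[OF assms] by eventually_elim (rule F_ordered_eq_poly)
  then have "(deriv ^^ i) (F_ordered N) z = (deriv ^^ i) (poly (ordered_poly N)) z"
    by (rule higher_deriv_cong_ev) simp
  then show ?thesis
    by (simp add: higher_deriv_poly)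
qed

text \<open>With \<open>w = z ^ (2 ^ N)\<close> the error is
  \<open>z * w * (w - 2) / (1 - z)\<^sup>2\<close>. For \<open>z\<close> in the disc,
  \<open>w\<close> has modulus at most \<open>s ^ N\<close>, \<open>w - 2\<close> at most
  \<open>3\<close>, and \<open>1 - z\<close> at least \<open>1 - s\<close>.\<close>

lemma uniform_limit_ordered_poly:
  assumes "0 < s" "s < 1"
  shows "uniform_limit (cball 0 s) (\<lambda>N. poly (cpoly (smult (4 ^ N) (ordered_poly N))))
    (\<lambda>z. z / (1 - z)\<^sup>2) sequentially"
proof (rule uniform_limitI)
  fix e :: real assume "e > 0"
  have "(\<lambda>N. 3 * s ^ N / (1 - s)\<^sup>2) \<longlonglongrightarrow> 3 * 0 / (1 - s)\<^sup>2"
    using assms by (intro tendsto_intros LIMSEQ_power_zero) auto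
  then have "\<forall>\<^sub>F N in sequentially. 3 * s ^ N / (1 - s)\<^sup>2 < e"
    using \<open>e > 0\<close> by (intro order_tendstoD) auto
  then show "\<forall>\<^sub>F N in sequentially. \<forall>z\<in>cball 0 s.
      dist (poly (cpoly (smult (4 ^ N) (ordered_poly N))) z) (z / (1 - z)\<^sup>2) < e"
  proof (eventually_elim, safe)
    fix N and z :: complex
    assume N: "3 * s ^ N / (1 - s)\<^sup>2 < e" and "z \<in> cball 0 s"
    then have z: "norm z \<le> s" by simp
    then have "z \<noteq> 1" using assms by auto
    let ?w = "z ^ (2 ^ N)"
    have "norm ?w \<le> s ^ (2 ^ N)"
      unfolding norm_power using z by (intro power_mono) auto
    also have "\<dots> \<le> s ^ N"
      using assms by (intro power_decreasing) auto
    finally have w: "norm ?w \<le> s ^ N" .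
    have "norm (?w - 2) \<le> norm ?w + 2"
      by (metis norm_numeral norm_triangle_ineq4)
    then have w2: "norm (?w - 2) \<le> 3"
      using w assms power_le_one[of s N] by linarith
    have "1 - s \<le> norm (1 - z)"
      using norm_triangle_ineq2[of 1 z] z by simp
    then have d: "(1 - s)\<^sup>2 \<le> (norm (1 - z))\<^sup>2"
      using assms by (intro power_mono) auto
    have "poly (cpoly (smult (4 ^ N) (ordered_poly N))) z - z / (1 - z)\<^sup>2
        = z * (?w * (?w - 2)) / (1 - z)\<^sup>2"
      unfolding poly_cpoly_ordered[OF \<open>z \<noteq> 1\<close>] power2_commute[of z]
      by (simp add: diff_divide_distrib[symmetric] power2_eq_square algebra_simps)
    then have "dist (poly (cpoly (smult (4 ^ N) (ordered_poly N))) z) (z / (1 - z)\<^sup>2)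
        = norm z * (norm ?w * norm (?w - 2)) / (norm (1 - z))\<^sup>2"
      by (simp add: dist_norm norm_mult norm_divide norm_power)
    also have "\<dots> \<le> 1 * (s ^ N * 3) / (1 - s)\<^sup>2"
      using assms z w w2 d by (intro frac_le mult_mono) auto
    also have "\<dots> < e"
      using N by (simp add: mult.commute)
    finally show "dist (poly (cpoly (smult (4 ^ N) (ordered_poly N))) z) (z / (1 - z)\<^sup>2) < e" .
  qed
qed

text \<open>Partial fractions:
  \<open>z / (1 - z)\<^sup>2 = 1 / (1 - z)\<^sup>2 - 1 / (1 - z)\<close>. Each derivative multiplies
  a term by its exponent and raises that exponent by one.\<close>

lemma higher_deriv_ordered_limit:
  fixes z :: complex
  assumes "z \<noteq> 1"
  shows "(deriv ^^ i) (\<lambda>z. z / (1 - z)\<^sup>2) z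
    = fact i * (of_nat (i + 1) / (1 - z) ^ (i + 2) - 1 / (1 - z) ^ (i + 1))"
  using assms
proof (induction i arbitrary: z)
  case 0
  then have "1 / (1 - z) = (1 - z) / (1 - z)\<^sup>2"
    by (simp add: power2_eq_square)
  then show ?case by (simp add: diff_divide_distrib power2_eq_square)
next
  case (Suc i)
  let ?g = "\<lambda>z::complex. fact i * (of_nat (i + 1) / (1 - z) ^ (i + 2) - 1 / (1 - z) ^ (i + 1))"
  have "\<forall>\<^sub>F w in nhds z. (deriv ^^ i) (\<lambda>z. z / (1 - z)\<^sup>2) w = ?g w"
    using t1_space_nhds[OF Suc.prems] by eventually_elim (rule Suc.IH)
  then have "(deriv ^^ Suc i) (\<lambda>z. z / (1 - z)\<^sup>2) z = deriv ?g z"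
    by (simp add: deriv_cong_ev)
  also have "\<dots> = fact i * (of_nat (i + 1) * (of_nat (i + 2) / (1 - z) ^ (i + 3))
      - of_nat (i + 1) / (1 - z) ^ (i + 2))"
  proof -
    have *: "((\<lambda>z. c / (1 - z) ^ k) has_field_derivative c * (of_nat k / (1 - z) ^ Suc k)) (at z)" for k and c :: complex
    proof (cases k)
      case (Suc m)
      then show ?thesis
        using \<open>z \<noteq> 1\<close>
        by (auto intro!: derivative_eq_intros simp: divide_simps simp del: of_nat_Suc power_Suc)
           (simp add: power_add [symmetric] algebra_simps power2_eq_square power_Suc)
    qed simp
    show ?thesis
      by (rule DERIV_imp_deriv DERIV_cmult DERIV_diff)+ 
        (insert *[of "of_nat (i+1)" "i+2"] *[of 1 "i+1"], simp_all add: numeral_eq_Suc)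
  qed
  also have "\<dots> = fact (Suc i) * (of_nat (Suc i + 1) / (1 - z) ^ (Suc i + 2) - 1 / (1 - z) ^ (Suc i + 1))"
    by (simp add: algebra_simps numeral_eq_Suc)
  finally show ?case .
qed

text \<open>Since \<open>P w = w * ((1 + w) / 2)\<^sup>2\<close>, a step keeps the disc of radius
  \<open>s\<close> and shrinks moduli there at least by the factor
  \<open>((1 + s) / 2)\<^sup>2 < 1\<close>.\<close>

lemma norm_P_iterate_le:
  fixes z :: complex
  assumes "norm z \<le> s" "s < 1"
  shows "norm ((P ^^ n) z) \<le> (((1 + s) / 2)\<^sup>2) ^ n * s"
proof (induction n)
  case (Suc n)
  define w where "w = (P ^^ n) z"
  have s: "0 \<le> s" using assms(1) norm_ge_zero order_trans by blast
  have "((1 + s) / 2)\<^sup>2 \<le> 1"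
    using s assms by (intro power_le_one) auto
  then have "(((1 + s) / 2)\<^sup>2) ^ n * s \<le> 1 * s"
    using s by (intro mult_right_mono power_le_one[of _ n]) auto
  with Suc have "norm w \<le> s"
    by (simp add: w_def)
  then have "norm (1 + w) \<le> 1 + s"
    using norm_triangle_ineq[of 1 w] by simp
  then have w: "norm ((1 + w) / 2) \<le> (1 + s) / 2"
    by (simp add: norm_divide)
  have "P w = ((1 + w) / 2)\<^sup>2 * w"
    by (simp add: P_def field_simps power2_eq_square power3_eq_cube)
  then have "norm (P w) = (norm ((1 + w) / 2))\<^sup>2 * norm w"
    by (simp add: norm_mult norm_power)
  also have "\<dots> \<le> ((1 + s) / 2)\<^sup>2 * ((((1 + s) / 2)\<^sup>2) ^ n * s)"
    using w Suc s unfolding w_def by (intro mult_mono power_mono) auto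
  finally show ?case
    by (simp add: w_def)
qed (use assms in simp)

text \<open>Since \<open>P w = w * ((1 + w) / 2)\<^sup>2\<close>, the scaled iterates are partial products of
  \<open>z * (\<Prod>k. (1 + (P ^^ k) z)\<^sup>2)\<close>, whose factors tend to \<open>1\<close> geometrically.\<close>

lemma uniform_limit_Phi:
  assumes "0 < s" "s < 1"
  shows "uniform_limit (cball 0 s) (\<lambda>N z. 4 ^ N * (P ^^ N) z) Phi sequentially"
proof -
  define q where "q = ((1 + s) / 2)\<^sup>2"
  have q: "0 \<le> q" "q < 1"
    using assms by (auto simp: q_def power_less_one_iff)
  define u where "u N z = 4 ^ N * (P ^^ N) z" for N and z :: complex
  have small: "norm ((P ^^ n) z) \<le> q ^ n" if "z \<in> cball 0 s" for n and z :: complex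
  proof -
    have "norm ((P ^^ n) z) \<le> q ^ n * s"
      unfolding q_def using that assms by (intro norm_P_iterate_le) auto
    also have "\<dots> \<le> q ^ n"
      using assms q by (intro mult_left_le) auto
    finally show ?thesis .
  qed
  have u_Suc: "u (Suc n) z = u n z * (1 + (P ^^ n) z)\<^sup>2" for n z
    by (simp add: u_def P_def algebra_simps power2_eq_square power3_eq_cube)
  have sum_q: "(\<Sum>k<n. q ^ k) \<le> 1 / (1 - q)" for n
    using q by (simp add: sum_gp_strict divide_simps)
  \<comment> \<open>The inequality \<open>1 + t \<le> exp t\<close> turns the product of the factors
    into the exponential of a geometric sum, bounded independently of \<open>n\<close> and
    \<open>z\<close>.\<close>
  have u_bound: "norm (u n z) \<le> exp (2 / (1 - q))" if z: "z \<in> cball 0 s" for n z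
  proof -
    have "norm (u n z) \<le> exp (2 * (\<Sum>k<n. q ^ k))"
    proof (induction n)
      case 0
      then show ?case using z assms by (simp add: u_def)
    next
      case (Suc n)
      have "norm (1 + (P ^^ n) z) \<le> 1 + q ^ n"
        using norm_triangle_ineq[of 1 "(P ^^ n) z"] small[OF z, of n] by simp
      also have "\<dots> \<le> exp (q ^ n)"
        by (rule exp_ge_add_one_self)
      finally have "(norm (1 + (P ^^ n) z))\<^sup>2 \<le> (exp (q ^ n))\<^sup>2"
        by (intro power_mono) auto
      with Suc have "norm (u (Suc n) z) \<le> exp (2 * (\<Sum>k<n. q ^ k)) * (exp (q ^ n))\<^sup>2"
        unfolding u_Suc norm_mult norm_power by (intro mult_mono) auto
      then show ?case
        by (simp add: exp_add distrib_left exp_double mult.commute)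
    qed
    also have "\<dots> \<le> exp (2 / (1 - q))"
      using sum_q[of n] by simp
    finally show ?thesis .
  qed
  \<comment> \<open>The increments of \<open>u\<close> are dominated by a geometric series, so the
    M-test applies to their telescoping sum.\<close>
  have "uniformly_convergent_on (cball 0 s) (\<lambda>n z. \<Sum>k<n. u (Suc k) z - u k z)"
  proof (rule Weierstrass_m_test')
    show "norm (u (Suc n) z - u n z) \<le> exp (2 / (1 - q)) * (3 * q ^ n)" if z: "z \<in> cball 0 s" for n z
    proof -
      let ?w = "(P ^^ n) z"
      have "norm (2 + ?w) \<le> 2 + norm ?w"
        by (metis norm_numeral norm_triangle_ineq)
      then have "norm (2 + ?w) \<le> 3"
        using small[OF z, of n] power_le_one[of q n] q by linarith
      then have "norm ((2 + ?w) * ?w) \<le> 3 * q ^ n"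
        unfolding norm_mult using small[OF z, of n] by (intro mult_mono) auto
      moreover have "u (Suc n) z - u n z = u n z * ((2 + ?w) * ?w)"
        by (simp add: u_Suc power2_eq_square algebra_simps)
      ultimately show ?thesis
        using u_bound[OF z] by (simp only: norm_mult) (rule mult_mono; simp)
    qed
    show "summable (\<lambda>n. exp (2 / (1 - q)) * (3 * q ^ n))"
      using q by (intro summable_mult summable_geometric) auto
  qed
  then have "uniformly_convergent_on (cball 0 s) (\<lambda>n z. u 0 z + (\<Sum>k<n. u (Suc k) z - u k z))"
    by (intro uniformly_convergent_add uniformly_convergent_on_const)
  also have "(\<lambda>n z. u 0 z + (\<Sum>k<n. u (Suc k) z - u k z)) = u"
    by (intro ext) (use sum_lessThan_telescope[of "\<lambda>k. u k z" n for z n] in simp)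
  finally have "uniformly_convergent_on (cball 0 s) u" .
  \<comment> \<open>\<open>Phi\<close> is by definition the pointwise \<open>lim\<close>, hence the
    uniform limit once uniform convergence is known.\<close>
  then show ?thesis
    unfolding uniformly_convergent_uniform_limit_iff u_def Phi_def .
qed

lemma uniform_limit_disordered_poly:
  assumes "0 < s" "s < 1"
  shows "uniform_limit (cball 0 s) (\<lambda>N. poly (cpoly (smult (4 ^ N) (disordered_poly N)))) Phi sequentially"
proof -
  have "poly (cpoly (smult (4 ^ N) (disordered_poly N))) = (\<lambda>z. 4 ^ N * (P ^^ N) z)" for N
    by (rule ext) (simp add: cpoly_smult poly_cpoly_disordered)
  then show ?thesis
    using uniform_limit_Phi[OF assms] by simp
qed

text \<open>The derivative of \<open>4 * P\<close> at \<open>w \<ge> 0\<close> is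
  \<open>1 + 4 * w + 3 * w\<^sup>2 \<ge> 1\<close>, so by the chain rule the scaled derivative
  starts at \<open>1\<close> and never decreases.\<close>

lemma pderiv_disordered_poly_ge:
  assumes "0 \<le> a"
  shows "1 \<le> poly (pderiv (smult (4 ^ N) (disordered_poly N))) a"
proof -
  have "0 \<le> poly (disordered_poly N) a \<and> 1 \<le> 4 ^ N * poly (pderiv (disordered_poly N)) a"
  proof (induction N)
    case 0
    then show ?case using assms by (simp add: disordered_poly_def pderiv_pCons)
  next
    case (Suc N)
    let ?q = "disordered_poly N"
    have Q: "disordered_poly (Suc N) = smult (1 / 4) (?q + smult 2 (?q\<^sup>2) + ?q ^ 3)"
      by (simp add: disordered_poly_def)
    have "4 ^ Suc N * poly (pderiv (disordered_poly (Suc N))) a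
       = 4 ^ N * poly (pderiv ?q) a * (1 + 4 * poly ?q a + 3 * (poly ?q a)\<^sup>2)"
      unfolding Q by (simp add: pderiv_smult pderiv_add pderiv_power_Suc pderiv_mult power2_eq_square power3_eq_cube algebra_simps)
    moreover have "1 \<le> 1 + 4 * poly ?q a + 3 * (poly ?q a)\<^sup>2"
      using Suc by simp
    ultimately have "1 * 1 \<le> 4 ^ Suc N * poly (pderiv (disordered_poly (Suc N))) a"
      using Suc by (simp only:) (rule mult_mono; auto)
    with Suc show ?case
      by (simp add: Q)
  qed
  then show ?thesis
    by (simp add: pderiv_smult)
qed

text \<open>A limit of reals that are at least \<open>1\<close> cannot vanish; this makes the limit
  of ratios in the disordered case meaningful.\<close>

lemma deriv_Phi_nonzero:
  assumes "0 \<le> a" "a < 1"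
  shows "deriv Phi (of_real a) \<noteq> 0"
proof
  assume "deriv Phi (of_real a) = 0"
  then have "(\<lambda>N. complex_of_real (poly (pderiv (smult (4 ^ N) (disordered_poly N))) a)) \<longlonglongrightarrow> of_real 0"
    using tendsto_higher_pderiv[OF uniform_limit_disordered_poly, of a 1] assms by simp
  then have "(\<lambda>N. poly (pderiv (smult (4 ^ N) (disordered_poly N))) a) \<longlonglongrightarrow> 0"
    by (simp only: tendsto_of_real_iff)
  then have "(1::real) \<le> 0"
    by (rule LIMSEQ_le_const) (use pderiv_disordered_poly_ge[OF \<open>0 \<le> a\<close>] in blast)
  then show False by simp
qed

text \<open>At \<open>1 - p\<close> the limit function has the derivatives
  \<open>fact i * (i + 1 - p) / p ^ (i + 2)\<close>; factorials and powers of \<open>p\<close>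
  cancel in the quotient.\<close>

lemma tendsto_relative_ordered:
  assumes "0 < p" "p \<le> 1"
  shows "(\<lambda>N. coeff (ordered_poly N \<circ>\<^sub>p [:1 - p, p:]) i / coeff (ordered_poly N \<circ>\<^sub>p [:1 - p, p:]) 1)
    \<longlonglongrightarrow> (real i + 1 - p) / (2 - p)"
proof -
  have ne: "complex_of_real (1 - p) \<noteq> 1"
    using assms by simp
  let ?G = "\<lambda>z::complex. z / (1 - z)\<^sup>2"
  have D: "(deriv ^^ i) ?G (of_real (1 - p)) = of_real (fact i * ((real i + 1 - p) / p ^ (i + 2)))" for i
  proof -
    have "real (i + 1) / p ^ (i + 2) - 1 / p ^ (i + 1) = (real i + 1 - p) / p ^ (i + 2)"
      using assms by (simp add: diff_divide_distrib add_divide_distrib)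
    moreover have "1 - complex_of_real (1 - p) = of_real p"
      by simp
    ultimately show ?thesis
      unfolding higher_deriv_ordered_limit[OF ne] \<open>1 - complex_of_real (1 - p) = of_real p\<close>
      by (simp only: of_real_1 of_real_diff of_real_divide of_real_fact of_real_mult
          of_real_of_nat_eq of_real_power flip: \<open>_ = (real i + 1 - p) / p ^ (i + 2)\<close>)
  qed
  have D1: "deriv ?G (of_real (1 - p)) = of_real ((2 - p) / p ^ 3)"
    using D[of 1] by (simp add: power3_eq_cube)
  have "(\<lambda>N. complex_of_real (coeff (ordered_poly N \<circ>\<^sub>p [:1 - p, p:]) i / coeff (ordered_poly N \<circ>\<^sub>p [:1 - p, p:]) 1))
    \<longlonglongrightarrow> (deriv ^^ i) ?G (of_real (1 - p)) * of_real (p powi (int i - 1)) / (deriv ?G (of_real (1 - p)) * fact i)"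
  proof (rule tendsto_relative_coeff[OF uniform_limit_ordered_poly])
    show "deriv ?G (of_real (1 - p)) \<noteq> 0"
      unfolding D1 of_real_eq_0_iff using assms by simp
  qed (use assms in auto)
  also have "(deriv ^^ i) ?G (of_real (1 - p)) * of_real (p powi (int i - 1)) / (deriv ?G (of_real (1 - p)) * fact i)
     = complex_of_real (fact i * ((real i + 1 - p) / p ^ (i + 2)) * p powi (int i - 1) / ((2 - p) / p ^ 3 * fact i))"
    unfolding D D1 by (simp only: of_real_mult of_real_divide of_real_fact)
  also have "fact i * ((real i + 1 - p) / p ^ (i + 2)) * p powi (int i - 1) / ((2 - p) / p ^ 3 * fact i) = (real i + 1 - p) / (2 - p)"
  proof -
    have "fact i * (c / p ^ (i + 2)) * (p ^ i / p) / (d / p ^ 3 * fact i) = c / d" for c d :: real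
      using assms by (simp add: power_add power2_eq_square power3_eq_cube)
    moreover have "p powi (int i - 1) = p ^ i / p"
      using assms by (simp add: power_int_diff)
    ultimately show ?thesis
      by (simp only:)
  qed
  finally show ?thesis
    by (simp only: tendsto_of_real_iff)
qed

subsection \<open>A law of large numbers for cell densities\<close>

context prob_space
begin

text \<open>Expand the square. For each \<open>j\<close> only the three indices in
  \<open>{j - 1..j + 1}\<close> can contribute, each at most \<open>1\<close>, so the second moment
  grows linearly as for independent summands.\<close>

lemma expectation_square_sum_le:
  fixes Z :: "int \<Rightarrow> 'a \<Rightarrow> real"
  assumes meas: "\<And>j. random_variable borel (Z j)" and bound: "\<And>j \<omega>. \<bar>Z j \<omega>\<bar> \<le> 1"
    and uncorr: "\<And>j k. j + 2 \<le> k \<Longrightarrow> expectation (\<lambda>\<omega>. Z j \<omega> * Z k \<omega>) = 0"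
    and "finite A"
  shows "expectation (\<lambda>\<omega>. (\<Sum>j\<in>A. Z j \<omega>)\<^sup>2) \<le> 3 * real (card A)"
proof -
  have prod_bound: "\<bar>Z j \<omega> * Z k \<omega>\<bar> \<le> 1" for j k \<omega>
    unfolding abs_mult using bound by (intro mult_le_one) auto
  have int: "integrable M (\<lambda>\<omega>. Z j \<omega> * Z k \<omega>)" for j k
    by (rule integrable_const_bound[where B = 1]) (use meas prod_bound in auto)
  have far: "expectation (\<lambda>\<omega>. Z j \<omega> * Z k \<omega>) = 0" if "k \<notin> {j - 1..j + 1}" for j k
  proof (cases "j < k")
    case True
    then show ?thesis using that by (intro uncorr) auto
  next
    case False
    then have "expectation (\<lambda>\<omega>. Z k \<omega> * Z j \<omega>) = 0"
      using that by (intro uncorr) auto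
    then show ?thesis by (simp add: mult.commute)
  qed
  have le1: "expectation (\<lambda>\<omega>. Z j \<omega> * Z k \<omega>) \<le> 1" for j k
    using prod_bound[of j _ k] by (intro integral_le_const int) (auto simp: abs_le_iff)
  have "expectation (\<lambda>\<omega>. (\<Sum>j\<in>A. Z j \<omega>)\<^sup>2) = (\<Sum>j\<in>A. \<Sum>k\<in>A. expectation (\<lambda>\<omega>. Z j \<omega> * Z k \<omega>))"
    by (simp add: power2_eq_square sum_product int)
  also have "\<dots> \<le> (\<Sum>j\<in>A. 3)"
  proof (rule sum_mono)
    fix j assume "j \<in> A"
    have "(\<Sum>k\<in>A. expectation (\<lambda>\<omega>. Z j \<omega> * Z k \<omega>))
        = (\<Sum>k\<in>A \<inter> {j - 1..j + 1}. expectation (\<lambda>\<omega>. Z j \<omega> * Z k \<omega>))"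
      using \<open>finite A\<close> far by (intro sum.mono_neutral_right) auto
    also have "\<dots> \<le> (\<Sum>k\<in>A \<inter> {j - 1..j + 1}. 1)"
      by (intro sum_mono le1)
    also have "\<dots> \<le> real (card {j - 1..j + 1})"
      by (simp del: card_atLeastAtMost_int add: card_mono)
    finally show "(\<Sum>k\<in>A. expectation (\<lambda>\<omega>. Z j \<omega> * Z k \<omega>)) \<le> 3"
      by simp
  qed
  finally show ?thesis by (simp add: mult.commute)
qed

text \<open>The series of the squares has finite expectation, hence converges almost surely, so its
  terms tend to \<open>0\<close>.\<close>

lemma AE_tendsto_0_if_summable_second_moments:
  fixes T :: "nat \<Rightarrow> 'a \<Rightarrow> real"
  assumes meas: "\<And>n. random_variable borel (T n)" and int: "\<And>n. integrable M (\<lambda>\<omega>. (T n \<omega>)\<^sup>2)"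
    and le: "\<And>n. expectation (\<lambda>\<omega>. (T n \<omega>)\<^sup>2) \<le> c n" and "summable c"
  shows "AE \<omega> in M. (\<lambda>n. T n \<omega>) \<longlonglongrightarrow> 0"
proof -
  have "(\<integral>\<^sup>+\<omega>. (\<Sum>n. ennreal ((T n \<omega>)\<^sup>2)) \<partial>M) = (\<Sum>n. \<integral>\<^sup>+\<omega>. ennreal ((T n \<omega>)\<^sup>2) \<partial>M)"
    using meas by (intro nn_integral_suminf) auto
  also have "\<dots> = (\<Sum>n. ennreal (expectation (\<lambda>\<omega>. (T n \<omega>)\<^sup>2)))"
    by (subst nn_integral_eq_integral) (use int in auto)
  also have "\<dots> \<le> (\<Sum>n. ennreal (c n))"
    using le by (intro suminf_le ennreal_leI) auto
  also have "\<dots> < \<infinity>"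
  proof -
    have "0 \<le> c n" for n
      using le[of n] by (rule order_trans[rotated]) simp
    then show ?thesis
      using \<open>summable c\<close> by (simp add: suminf_ennreal2)
  qed
  finally have "AE \<omega> in M. (\<Sum>n. ennreal ((T n \<omega>)\<^sup>2)) \<noteq> \<infinity>"
    using meas by (intro nn_integral_noteq_infinite) auto
  then show ?thesis
  proof eventually_elim
    case (elim \<omega>)
    then have "summable (\<lambda>n. (T n \<omega>)\<^sup>2)"
      by (intro summable_suminf_not_top) auto
    then have "(\<lambda>n. (T n \<omega>)\<^sup>2) \<longlonglongrightarrow> 0"
      by (rule summable_LIMSEQ_zero)
    then have "(\<lambda>n. sqrt ((T n \<omega>)\<^sup>2)) \<longlonglongrightarrow> sqrt 0"
      by (intro tendsto_intros)
    then show ?case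
      by (simp add: tendsto_rabs_zero_iff)
  qed
qed

end

text \<open>Between consecutive squares the numerator changes by a lower order term only.\<close>

lemma tendsto_average_if_squares:
  fixes z :: "int \<Rightarrow> real"
  assumes bound: "\<And>j. \<bar>z j\<bar> \<le> 1"
    and sq: "(\<lambda>m. (\<Sum>j\<in>{- int (m\<^sup>2)..<int (m\<^sup>2)}. z j) / real (m\<^sup>2)) \<longlonglongrightarrow> 0"
  shows "(\<lambda>L. (\<Sum>j\<in>{- int L..<int L}. z j) / real L) \<longlonglongrightarrow> 0"
proof -
  define S where "S L = (\<Sum>j\<in>{- int L..<int L}. z j)" for L
  \<comment> \<open>For \<open>m\<^sup>2 \<le> L < (m + 1)\<^sup>2\<close> the two sums differ by at
    most \<open>4 * m\<close> terms, which after division by \<open>m\<^sup>2\<close> gives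
    \<open>4 / m\<close>.\<close>
  let ?b = "\<lambda>m. \<bar>S (m\<^sup>2) / real (m\<^sup>2)\<bar> + 4 / real m"
  have "(\<lambda>m. \<bar>S (m\<^sup>2) / real (m\<^sup>2)\<bar> + 4 / real m) \<longlonglongrightarrow> \<bar>0\<bar> + 0"
    using sq unfolding S_def by (intro tendsto_intros lim_const_over_n)
  then have b: "?b \<longlonglongrightarrow> 0" by simp
  have fs: "filterlim floor_sqrt at_top at_top"
    unfolding filterlim_at_top
  proof
    fix n
    have "n \<le> floor_sqrt L" if "n\<^sup>2 \<le> L" for L
      using that by (simp add: le_floor_sqrt_iff)
    then show "\<forall>\<^sub>F L in sequentially. n \<le> floor_sqrt L"
      unfolding eventually_sequentially by blast
  qed
  have "\<forall>\<^sub>F L in sequentially. norm (S L / real L) \<le> ?b (floor_sqrt L)"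
    using eventually_gt_at_top[of 0]
  proof eventually_elim
    fix L :: nat assume "L > 0"
    define m where "m = floor_sqrt L"
    have m: "m > 0" "m\<^sup>2 \<le> L" "L \<le> m\<^sup>2 + 2 * m"
      using \<open>L > 0\<close> Suc_floor_sqrt_power2_gt[of L] floor_sqrt_power2_le[of L]
      by (auto simp: m_def power2_eq_square simp del: floor_sqrt_power2_le)
    have "S L - S (m\<^sup>2) = (\<Sum>j\<in>{- int L..<int L} - {- int (m\<^sup>2)..<int (m\<^sup>2)}. z j)"
      unfolding S_def using m by (subst sum_diff) auto
    also have "\<bar>\<dots>\<bar> \<le> (\<Sum>j\<in>{- int L..<int L} - {- int (m\<^sup>2)..<int (m\<^sup>2)}. 1)"
      using bound by (intro order_trans[OF sum_abs] sum_mono)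
    also have "\<dots> = real (card ({- int L..<int L} - {- int (m\<^sup>2)..<int (m\<^sup>2)}))"
      by simp
    also have "card ({- int L..<int L} - {- int (m\<^sup>2)..<int (m\<^sup>2)}) = 2 * L - 2 * m\<^sup>2"
      using m by (subst card_Diff_subset) (auto simp: nat_mult_distrib simp flip: of_nat_power)
    also have "real (2 * L - 2 * m\<^sup>2) \<le> real (4 * m)"
      using m by (intro of_nat_mono) linarith
    finally have "\<bar>S L - S (m\<^sup>2)\<bar> \<le> 4 * real m" by simp
    then have SL: "\<bar>S L\<bar> \<le> \<bar>S (m\<^sup>2)\<bar> + 4 * real m" by linarith
    have "norm (S L / real L) \<le> (\<bar>S (m\<^sup>2)\<bar> + 4 * real m) / real (m\<^sup>2)"
      using SL m \<open>L > 0\<close> by (simp del: of_nat_power) (intro frac_le, auto)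
    also have "\<dots> = ?b m"
      using m by (simp add: add_divide_distrib power2_eq_square)
    finally show "norm (S L / real L) \<le> ?b (floor_sqrt L)"
      unfolding m_def .
  qed
  then have "(\<lambda>L. S L / real L) \<longlonglongrightarrow> 0"
    by (rule Lim_null_comparison) (rule filterlim_compose[OF b fs])
  then show ?thesis
    unfolding S_def .
qed

text \<open>The sum of the centred indicators over radius \<open>m\<^sup>2\<close>, divided by
  \<open>m\<^sup>2\<close>, has second moment at most \<open>6 / m\<^sup>2\<close>, which is
  summable; for radius \<open>L\<close> the bound \<open>6 / L\<close> would not be. The distance is
  \<open>2\<close> because in the ordered chain neighbouring blocks share an end.\<close>

lemma (in prob_space) AE_has_cell_density:
  assumes meas: "\<And>j. random_variable (count_space UNIV) (X j)"
    and one: "\<And>j. prob {\<omega> \<in> space M. X j \<omega> = i} = q"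
    and two: "\<And>j k. j + 2 \<le> k \<Longrightarrow> prob {\<omega> \<in> space M. X j \<omega> = i \<and> X k \<omega> = i} = q\<^sup>2"
  shows "AE \<omega> in M. has_cell_density (\<lambda>j. X j \<omega>) i q"
proof -
  define A where "A j = {\<omega> \<in> space M. X j \<omega> = i}" for j
  have A[measurable]: "A j \<in> events" for j
    unfolding A_def using measurable_sets[OF meas, of "{i}" j] by (simp add: vimage_def Int_def conj_commute)
  have q: "0 \<le> q" "q \<le> 1"
    using one[of 0] by auto
  define Z :: "int \<Rightarrow> 'a \<Rightarrow> real" where "Z j \<omega> = indicator (A j) \<omega> - q" for j \<omega>
  have [measurable]: "random_variable borel (Z j)" for j
    unfolding Z_def by measurable
  have Z_bound: "\<bar>Z j \<omega>\<bar> \<le> 1" for j \<omega>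
    using q by (auto simp: Z_def indicator_def)
  have uncorr: "expectation (\<lambda>\<omega>. Z j \<omega> * Z k \<omega>) = 0" if "j + 2 \<le> k" for j k
  proof -
    have "expectation (\<lambda>\<omega>. Z j \<omega> * Z k \<omega>)
      = expectation (\<lambda>\<omega>. indicator (A j \<inter> A k) \<omega> - q * indicator (A j) \<omega> - q * indicator (A k) \<omega> + q\<^sup>2)"
      by (simp add: Z_def algebra_simps indicator_inter_arith power2_eq_square)
    also have "\<dots> = prob (A j \<inter> A k) - q * prob (A j) - q * prob (A k) + q\<^sup>2"
    proof -
      have "integrable M (\<lambda>\<omega>. indicator B \<omega> :: real)" if "B \<in> events" for B
        using that by (simp add: integrable_real_indicator emeasure_eq_measure)
      from this[OF A] this[OF sets.Int[OF A A]] show ?thesis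
        by (simp add: prob_space)
    qed
    also have "A j \<inter> A k = {\<omega> \<in> space M. X j \<omega> = i \<and> X k \<omega> = i}"
      by (auto simp: A_def)
    finally show ?thesis
      using two[OF that] one by (simp add: A_def power2_eq_square)
  qed
  define T where "T m \<omega> = (\<Sum>j\<in>{- int (m\<^sup>2)..<int (m\<^sup>2)}. Z j \<omega>) / real (m\<^sup>2)" for m \<omega>
  have T_bound: "\<bar>T m \<omega>\<bar> \<le> 2" for m \<omega>
  proof -
    have "\<bar>\<Sum>j\<in>{- int (m\<^sup>2)..<int (m\<^sup>2)}. Z j \<omega>\<bar> \<le> (\<Sum>j\<in>{- int (m\<^sup>2)..<int (m\<^sup>2)}. 1)"
      using Z_bound by (intro order_trans[OF sum_abs] sum_mono)
    then show ?thesis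
      by (cases "m = 0") (simp_all add: T_def field_simps)
  qed
  have T_meas [measurable]: "random_variable borel (T m)" for m
    unfolding T_def by measurable
  have "AE \<omega> in M. (\<lambda>m. T m \<omega>) \<longlonglongrightarrow> 0"
  proof (rule AE_tendsto_0_if_summable_second_moments)
    show "integrable M (\<lambda>\<omega>. (T m \<omega>)\<^sup>2)" for m
      using T_bound abs_le_square_iff[of _ "2 :: real"]
      by (intro integrable_const_bound[where B = "2\<^sup>2"]) auto
    show "expectation (\<lambda>\<omega>. (T m \<omega>)\<^sup>2) \<le> 6 * (1 / real m ^ 2)" for m
    proof (cases "m = 0")
      case False
      have "expectation (\<lambda>\<omega>. (T m \<omega>)\<^sup>2)
          = expectation (\<lambda>\<omega>. (\<Sum>j\<in>{- int (m\<^sup>2)..<int (m\<^sup>2)}. Z j \<omega>)\<^sup>2) / (real (m\<^sup>2))\<^sup>2"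
        by (simp add: T_def power_divide)
      also have "\<dots> \<le> 3 * real (card {- int (m\<^sup>2)..<int (m\<^sup>2)}) / (real (m\<^sup>2))\<^sup>2"
        by (intro divide_right_mono expectation_square_sum_le[OF _ Z_bound uncorr]) auto
      also have "\<dots> = 6 * (1 / real m ^ 2)"
        using False by (simp add: power2_eq_square)
      finally show ?thesis .
    qed (simp add: T_def)
    show "summable (\<lambda>m. 6 * (1 / real m ^ 2))"
      using inverse_power_summable[of 2, where ?'a = real] by (intro summable_mult) (simp add: inverse_eq_divide)
  qed simp
  then show ?thesis
    using AE_space
  proof eventually_elim
    case (elim \<omega>)
    have "(\<lambda>L. (\<Sum>j\<in>{- int L..<int L}. Z j \<omega>) / real L) \<longlonglongrightarrow> 0"
      using elim Z_bound unfolding T_def by (intro tendsto_average_if_squares)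
    \<comment> \<open>The sum has \<open>2 * L\<close> terms but is divided by \<open>L\<close>,
      hence the factor \<open>1 / 2\<close>; adding \<open>q\<close> undoes the centring.\<close>
    then have "(\<lambda>L. (\<Sum>j\<in>{- int L..<int L}. Z j \<omega>) / real L / 2 + q) \<longlonglongrightarrow> 0 / 2 + q"
      by (intro tendsto_intros) auto
    moreover have "\<forall>\<^sub>F L in sequentially. (\<Sum>j\<in>{- int L..<int L}. Z j \<omega>) / real L / 2 + q
        = empirical_density (\<lambda>j. X j \<omega>) i L"
      using eventually_gt_at_top[of 0]
    proof eventually_elim
      fix L :: nat assume "L > 0"
      have "(\<Sum>j\<in>{- int L..<int L}. indicator (A j) \<omega>) = real (card {j \<in> {- int L..<int L}. X j \<omega> = i})"
      proof -
        have "(\<Sum>j\<in>{- int L..<int L}. indicator (A j) \<omega>)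
            = (\<Sum>j\<in>{- int L..<int L}. if X j \<omega> = i then 1 else (0::real))"
          using elim by (intro sum.cong) (auto simp: A_def)
        also have "\<dots> = real (card ({- int L..<int L} \<inter> {j. X j \<omega> = i}))"
          by (simp add: sum.If_cases)
        finally show ?thesis
          by (simp add: Int_def)
      qed
      then show "(\<Sum>j\<in>{- int L..<int L}. Z j \<omega>) / real L / 2 + q = empirical_density (\<lambda>j. X j \<omega>) i L"
        using \<open>L > 0\<close> by (simp add: Z_def sum_subtractf empirical_density_def field_simps)
    qed
    ultimately show ?case
      unfolding has_cell_density_def by (simp add: filterlim_cong)
  qed
qed

subsection \<open>Laws of the weights\<close>

lemma measurable_sum_nat:
  fixes f :: "'i \<Rightarrow> 'a \<Rightarrow> nat"
  assumes "\<And>k. k \<in> K \<Longrightarrow> f k \<in> measurable N (count_space UNIV)"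
  shows "(\<lambda>\<omega>. \<Sum>k\<in>K. f k \<omega>) \<in> measurable N (count_space UNIV)"
proof -
  have eq: "measurable N (count_space UNIV) = (borel_measurable N :: ('a \<Rightarrow> nat) set)"
    by (rule measurable_cong_sets) (simp_all add: sets_borel_eq_count_space)
  show ?thesis
    using assms unfolding eq by (rule borel_measurable_sum)
qed

text \<open>The two sums are functions of disjoint subfamilies of an independent family.\<close>

lemma (in prob_space) prob_disjoint_sums:
  fixes X :: "'i \<Rightarrow> 'a \<Rightarrow> nat"
  assumes indep: "indep_vars (\<lambda>_. count_space UNIV) X UNIV" and "K \<inter> K' = {}"
  shows "prob {\<omega> \<in> space M. (\<Sum>k\<in>K. X k \<omega>) = i \<and> (\<Sum>k\<in>K'. X k \<omega>) = i'}
    = prob {\<omega> \<in> space M. (\<Sum>k\<in>K. X k \<omega>) = i} * prob {\<omega> \<in> space M. (\<Sum>k\<in>K'. X k \<omega>) = i'}"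
proof -
  have meas: "(\<lambda>f. \<Sum>k\<in>J. f k :: nat) \<in> measurable (Pi\<^sub>M J (\<lambda>_. count_space UNIV)) (count_space UNIV)"
    for J :: "'i set"
    using measurable_sum_nat[of J "\<lambda>k f. f k", OF measurable_component_singleton] by simp
  have "indep_var (count_space UNIV) ((\<lambda>f. \<Sum>k\<in>K. f k) \<circ> (\<lambda>\<omega>. restrict (\<lambda>k. X k \<omega>) K))
      (count_space UNIV) ((\<lambda>f. \<Sum>k\<in>K'. f k) \<circ> (\<lambda>\<omega>. restrict (\<lambda>k. X k \<omega>) K'))"
    by (intro indep_var_compose[OF indep_var_restrict[OF indep]] meas) (use assms in auto)
  then have "indep_var (count_space UNIV) (\<lambda>\<omega>. \<Sum>k\<in>K. X k \<omega>) (count_space UNIV) (\<lambda>\<omega>. \<Sum>k\<in>K'. X k \<omega>)"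
    by (simp add: comp_def)
  from indep_varD[OF this, of "{i}" "{i'}"] show ?thesis
    by (simp add: vimage_def Int_def conj_commute)
qed

text \<open>Convolution of laws is multiplication of generating polynomials: splitting by the value
  \<open>l\<close> of one summand gives the coefficient formula of a product.\<close>

lemma (in prob_space) prob_sum_eq_coeff:
  fixes X :: "'i \<Rightarrow> 'a \<Rightarrow> nat" and G :: "real poly"
  assumes indep: "indep_vars (\<lambda>_. count_space UNIV) X UNIV"
    and law: "\<And>k i. prob {\<omega> \<in> space M. X k \<omega> = i} = coeff G i"
    and "finite K"
  shows "prob {\<omega> \<in> space M. (\<Sum>k\<in>K. X k \<omega>) = i} = coeff (G ^ card K) i"
  using \<open>finite K\<close>
proof (induction K arbitrary: i)
  case empty
  then show ?case by (cases "i = 0") (simp_all add: prob_space)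
next
  case (insert k K)
  have X [measurable]: "random_variable (count_space UNIV) (X k)" for k
    using indep by (simp add: indep_vars_def)
  have S [measurable]: "random_variable (count_space UNIV) (\<lambda>\<omega>. \<Sum>k\<in>K. X k \<omega>)"
    by (rule measurable_sum_nat) simp
  let ?E = "\<lambda>l. {\<omega> \<in> space M. X k \<omega> = l \<and> (\<Sum>k\<in>K. X k \<omega>) = i - l}"
  have "{\<omega> \<in> space M. (\<Sum>k\<in>insert k K. X k \<omega>) = i} = (\<Union>l\<in>{..i}. ?E l)"
    using insert by auto
  also have "prob \<dots> = (\<Sum>l\<le>i. prob (?E l))"
    by (intro finite_measure_finite_Union) (auto simp: disjoint_family_on_def)
  also have "\<dots> = (\<Sum>l\<le>i. coeff G l * coeff (G ^ card K) (i - l))"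
    using prob_disjoint_sums[OF indep, of "{k}" K] insert by (simp add: law)
  finally show ?case
    using insert by (simp add: coeff_mult)
qed

section \<open>Block boundaries in the ordered chain\<close>

text \<open>The left end, in the initial chain, of the block merged into cell \<open>j\<close> after
  \<open>n\<close> steps. If the even cell \<open>2 * j\<close> moves right, the block starts with
  it, otherwise with \<open>2 * j + 1\<close>. The block stops just before the boundary of
  \<open>j + 1\<close>, as every even cell joins exactly one side.\<close>

primrec boundary :: "(nat \<Rightarrow> int \<Rightarrow> bool) \<Rightarrow> nat \<Rightarrow> int \<Rightarrow> int" where
  "boundary r 0 j = j"
| "boundary r (Suc n) j = boundary r n (2 * j + (if r n j then 0 else 1))"

text \<open>Each step appends one binary digit chosen by a move, so the boundary is \<open>j\<close>
  followed by \<open>n\<close> digits. Boundaries of different cells thus lie in different windows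
  of length \<open>2 ^ n\<close>.\<close>

lemma boundary_div: "boundary r n j div 2 ^ n = j"
proof (induction n arbitrary: j)
  case (Suc n)
  have "boundary r (Suc n) j div 2 ^ Suc n = (boundary r n (2 * j + (if r n j then 0 else 1)) div 2 ^ n) div 2"
    by (simp add: zdiv_zmult2_eq[symmetric] mult.commute)
  also have "\<dots> = j"
    unfolding Suc by simp
  finally show ?case .
qed simp

lemma boundary_mono:
  assumes "j \<le> k"
  shows "boundary r n j \<le> boundary r n k"
proof (rule ccontr)
  assume *: "\<not> ?thesis"
  then have "boundary r n k div 2 ^ n \<le> boundary r n j div 2 ^ n"
    by (intro zdiv_mono1) auto
  then have "j = k"
    using assms by (simp add: boundary_div)
  then show False
    using * by simp
qed

text \<open>Ranges of cells are needed because one cell after \<open>Suc n\<close> steps collects a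
  range of one to three cells after \<open>n\<close> steps. Adjacent ranges share a boundary, so
  their blocks join without gap.\<close>

lemma ordered_sum_eq:
  assumes step: "\<And>n j. x (Suc n) j = merge (r n) (x n) j"
  shows "u \<le> v \<Longrightarrow> (\<Sum>k\<in>{u..<v}. x n k) = (\<Sum>k\<in>{boundary r n u..<boundary r n v}. x 0 k)"
proof (induction n arbitrary: u v)
  case (Suc n)
  have one: "x (Suc n) j = (\<Sum>k\<in>{boundary r (Suc n) j..<boundary r (Suc n) (j + 1)}. x 0 k)" for j
  proof -
    let ?a = "2 * j + (if r n j then 0 else 1)" and ?b = "2 * (j + 1) + (if r n (j + 1) then 0 else 1)"
    have "{2 * j..<2 * j + 2} = {2 * j, 2 * j + 1}" "{2 * j..<2 * j + 3} = {2 * j, 2 * j + 1, 2 * j + 2}"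
      "{2 * j + 1..<2 * j + 2} = {2 * j + 1}" "{2 * j + 1..<2 * j + 3} = {2 * j + 1, 2 * j + 2}"
      by auto
    then have "x (Suc n) j = (\<Sum>k\<in>{?a..<?b}. x n k)"
      by (auto simp: step merge_def algebra_simps)
    also have "\<dots> = (\<Sum>k\<in>{boundary r n ?a..<boundary r n ?b}. x 0 k)"
      by (rule Suc.IH) auto
    finally show ?thesis
      by simp
  qed
  show ?case
    using \<open>u \<le> v\<close>
  proof (induction v rule: int_ge_induct)
    case (step v)
    let ?B = "boundary r (Suc n)"
    have "{u..<v + 1} = insert v {u..<v}"
      using step by auto
    then have "(\<Sum>k\<in>{u..<v + 1}. x (Suc n) k) = (\<Sum>k\<in>{?B u..<?B v}. x 0 k) + (\<Sum>k\<in>{?B v..<?B (v + 1)}. x 0 k)"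
      using step.IH one[of v] by (simp del: boundary.simps)
    also have "\<dots> = (\<Sum>k\<in>{?B u..<?B v} \<union> {?B v..<?B (v + 1)}. x 0 k)"
      by (rule sum.union_disjoint[symmetric]) auto
    also have "{?B u..<?B v} \<union> {?B v..<?B (v + 1)} = {?B u..<?B (v + 1)}"
      using step by (intro ivl_disj_un_two(3) boundary_mono) auto
    finally show ?case .
  qed simp
qed simp

lemma ordered_state:
  assumes "\<And>n j. x (Suc n) j = merge (r n) (x n) j"
  shows "x n j = (\<Sum>k\<in>{boundary r n j..<boundary r n (j + 1)}. x 0 k)"
proof -
  have "{j..<j + 1} = {j}" by auto
  then show ?thesis
    using ordered_sum_eq[where x = x and r = r, OF assms, of j "j + 1" n] by simp
qed

section \<open>Independence of the moves from the past\<close>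

lemma generators_subset: "generators M X \<subseteq> Pow (space M)"
  by (auto simp: generators_def)

lemma past_generators_subset:
  "(\<Union>k\<in>{..n}. generators M (x k)) \<union> (\<Union>k\<in>{..<n}. generators M (r k)) \<subseteq> Pow (space M)"
  by (auto simp: generators_def)

lemma past_events_Suc: "past_events M x r n \<subseteq> past_events M x r (Suc n)"
  unfolding past_events_def by (intro sigma_sets_subseteq Un_mono UN_mono) simp_all

lemma moves_in_past: "sigma_sets (space M) (generators M (r n)) \<subseteq> past_events M x r (Suc n)"
  unfolding past_events_def lessThan_Suc by (intro sigma_sets_subseteq) blast

lemma past_events_Int:
  assumes "A \<in> past_events M x r n" "B \<in> past_events M x r n"
  shows "A \<inter> B \<in> past_events M x r n"
proof -
  interpret sigma_algebra "space M" "past_events M x r n"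
    unfolding past_events_def by (rule sigma_algebra_sigma_sets[OF past_generators_subset])
  show ?thesis
    using assms by (rule Int)
qed

lemma sum_event_in_past:
  assumes "k \<le> n"
  shows "{\<omega> \<in> space M. (\<Sum>j\<in>K. x k j \<omega>) = i} \<in> past_events M x r n"
proof -
  \<comment> \<open>A measure space whose measurable sets are exactly the past events opens the past
    to the general measurability rules.\<close>
  define N where "N = sigma (space M) ((\<Union>k\<in>{..n}. generators M (x k)) \<union> (\<Union>k\<in>{..<n}. generators M (r k)))"
  have N: "space N = space M" "sets N = past_events M x r n"
    unfolding N_def past_events_def using past_generators_subset[where M = M and n = n and x = x and r = r] by (simp_all add: space_measure_of)
  have "x k j \<in> measurable N (count_space UNIV)" for j
  proof (rule measurableI)
    show "x k j -` A \<inter> space N \<in> sets N" for A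
      unfolding N past_events_def using assms
      by (intro sigma_sets.Basic) (auto simp: generators_def)
  qed simp
  then have "(\<lambda>\<omega>. \<Sum>j\<in>K. x k j \<omega>) \<in> measurable N (count_space UNIV)"
    by (intro measurable_sum_nat)
  from measurable_sets[OF this, of "{i}"] show ?thesis
    by (simp add: N vimage_def Int_def conj_commute)
qed

lemma move_event_in_sigma:
  assumes "finite J"
  shows "{\<omega> \<in> space M. \<forall>j\<in>J. r j \<omega> = c j} \<in> sigma_sets (space M) (generators M r)"
proof -
  interpret sigma_algebra "space M" "sigma_sets (space M) (generators M r)"
    by (rule sigma_algebra_sigma_sets[OF generators_subset])
  show ?thesis
  proof (rule sets_Collect_finite_All[OF _ assms])
    fix j
    show "{\<omega> \<in> space M. r j \<omega> = c j} \<in> sigma_sets (space M) (generators M r)"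
    proof (rule sigma_sets.Basic)
      have "{\<omega> \<in> space M. r j \<omega> = c j} = r j -` {c j} \<inter> space M"
        by auto
      then show "{\<omega> \<in> space M. r j \<omega> = c j} \<in> generators M r"
        unfolding generators_def by blast
    qed
  qed
qed

context prob_space
begin

text \<open>Independence of two set systems includes that both consist of events, so
  \<open>fair_moves\<close> carries the measurability of the past.\<close>

lemma past_subset_events:
  assumes "fair_moves M x r"
  shows "past_events M x r n \<subseteq> events"
  using assms unfolding fair_moves_def indep_sets2_eq by blast

lemma prob_moves:
  assumes "fair_moves M x r" "finite J"
  shows "prob {\<omega> \<in> space M. \<forall>j\<in>J. r n j \<omega> = c j} = (1 / 2) ^ card J"
proof (cases "J = {}")
  case False
  have indep: "indep_vars (\<lambda>_. count_space UNIV) (r n) UNIV"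
    and half: "prob {\<omega> \<in> space M. r n j \<omega>} = 1 / 2" for j
    using assms by (simp_all add: fair_moves_def)
  have [measurable]: "random_variable (count_space UNIV) (r n j)" for j
    using indep by (simp add: indep_vars_def)
  have "prob (r n j -` {c j} \<inter> space M) = 1 / 2" for j
  proof (cases "c j")
    case True
    then show ?thesis using half[of j] by (simp add: vimage_def Int_def conj_commute)
  next
    case False
    then have "r n j -` {c j} \<inter> space M = {\<omega> \<in> space M. \<not> r n j \<omega>}"
      by auto
    then show ?thesis
      using half[of j] by (simp add: prob_neg)
  qed
  then have "(\<Prod>j\<in>J. prob (r n j -` {c j} \<inter> space M)) = (1 / 2) ^ card J"
    by (simp only: prod_constant)
  \<comment> \<open>An empty intersection would be \<open>UNIV\<close> instead of
    \<open>space M\<close>, hence the case distinction on \<open>J\<close>.\<close>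
  moreover have "{\<omega> \<in> space M. \<forall>j\<in>J. r n j \<omega> = c j} = (\<Inter>j\<in>J. r n j -` {c j} \<inter> space M)"
    using False by auto
  ultimately show ?thesis
    using indep_varsD[OF indep, of J "\<lambda>j. {c j}"] False assms(2) by (simp only:) simp
qed (simp add: prob_space)

lemma prob_moves_past:
  assumes "fair_moves M x r" "finite J" "A \<in> past_events M x r n"
  shows "prob ({\<omega> \<in> space M. \<forall>j\<in>J. r n j \<omega> = c j} \<inter> A) = (1 / 2) ^ card J * prob A"
proof -
  have "indep_set (sigma_sets (space M) (generators M (r n))) (past_events M x r n)"
    using assms(1) by (simp add: fair_moves_def)
  from indep_setD[OF this move_event_in_sigma[OF assms(2)] assms(3)] show ?thesis
    by (simp add: prob_moves[OF assms(1,2)])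
qed

text \<open>Reaching \<open>t\<close> prescribes one move at each of the \<open>n\<close> steps,
  namely the digits of \<open>t\<close>. By injectivity different targets prescribe moves of
  different cells, so \<open>n * card T\<close> fair moves are fixed. The induction splits off the
  last moves, which are independent of the past, and that contains \<open>A\<close> and the earlier
  moves. A general \<open>T\<close> covers one cell (two ends) and two cells (four ends).\<close>

lemma boundary_event:
  assumes fair: "fair_moves M x r" and A: "A \<in> past_events M x r 0"
    and "finite T" and inj: "inj_on (\<lambda>t. t div 2 ^ n) T"
  defines "E \<equiv> \<lambda>n. {\<omega> \<in> space M. \<forall>t\<in>T. boundary (\<lambda>n j. r n j \<omega>) n (t div 2 ^ n) = t}"
  shows "E n \<inter> A \<in> past_events M x r n" and "prob (E n \<inter> A) = (1 / 2) ^ (n * card T) * prob A"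
proof -
  have "E n \<inter> A \<in> past_events M x r n \<and> prob (E n \<inter> A) = (1 / 2) ^ (n * card T) * prob A"
    using inj
  proof (induction n)
    case 0
    have "A \<subseteq> space M"
      using A past_subset_events[OF fair] sets.sets_into_space by blast
    then have "E 0 \<inter> A = A"
      by (auto simp: E_def)
    then show ?case using A by simp
  next
    case (Suc n)
    have dd: "t div 2 ^ Suc n = (t div 2 ^ n) div 2" for t :: int
      by (simp add: zdiv_zmult2_eq[symmetric] mult.commute)
    from Suc.prems have inj_n: "inj_on (\<lambda>t. t div 2 ^ n) T"
      unfolding dd inj_on_def by metis
    define f where "f t = t div 2 ^ Suc n" for t :: int
    have f: "inj_on f T"
      using Suc.prems unfolding f_def .
    \<comment> \<open>The value demanded of \<open>r n j\<close> by the unique target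
      \<open>t\<close> with \<open>f t = j\<close>: right if \<open>t div 2 ^ n\<close> is
      \<open>2 * j\<close>, left if it is \<open>2 * j + 1\<close>.\<close>
    define c where "c j = even (inv_into T f j div 2 ^ n)" for j
    have c: "c (f t) = even (t div 2 ^ n)" if "t \<in> T" for t
      using f that by (simp add: c_def)
    let ?R = "{\<omega> \<in> space M. \<forall>j\<in>f ` T. r n j \<omega> = c j}"
    have step: "boundary \<rho> (Suc n) (f t) = t \<longleftrightarrow> \<rho> n (f t) = even (t div 2 ^ n) \<and> boundary \<rho> n (t div 2 ^ n) = t"
      (is "?L \<longleftrightarrow> ?C \<and> ?B") for \<rho> t
    proof -
      let ?m = "2 * f t + (if \<rho> n (f t) then 0 else 1)"
      have parity: "b = even m \<longleftrightarrow> 2 * (m div 2) + (if b then 0 else 1) = m" for b and m :: int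
        by (cases b) (simp; presburger)+
      have "?C \<longleftrightarrow> ?m = t div 2 ^ n"
          unfolding f_def dd by (rule parity)
      moreover have "?m = t div 2 ^ n" if ?L
        using boundary_div[of \<rho> n ?m] that by simp
      ultimately show ?thesis
        by auto
    qed
    have "E (Suc n) = ?R \<inter> E n"
      unfolding E_def f_def[symmetric] using c by (auto simp: step simp del: boundary.simps)
    then have E: "E (Suc n) \<inter> A = ?R \<inter> (E n \<inter> A)"
      by auto
    have "E n \<inter> A \<in> past_events M x r n" "prob (E n \<inter> A) = (1 / 2) ^ (n * card T) * prob A"
      using Suc.IH[OF inj_n] by auto
    moreover have "?R \<in> past_events M x r (Suc n)"
      using move_event_in_sigma[of "f ` T"] moves_in_past \<open>finite T\<close> by blast
    ultimately have "?R \<inter> (E n \<inter> A) \<in> past_events M x r (Suc n)"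
      and "prob (?R \<inter> (E n \<inter> A)) = (1 / 2) ^ card (f ` T) * ((1 / 2) ^ (n * card T) * prob A)"
      using past_events_Suc past_events_Int prob_moves_past[OF fair, of "f ` T" "E n \<inter> A" n c] \<open>finite T\<close>
      by (blast, simp)
    then show ?case
      unfolding E by (simp add: card_image[OF f] power_add)
  qed
  then show "E n \<inter> A \<in> past_events M x r n" "prob (E n \<inter> A) = (1 / 2) ^ (n * card T) * prob A"
    by auto
qed

lemma prob_partition:
  assumes "finite V" "\<And>\<omega>. \<omega> \<in> space M \<Longrightarrow> f \<omega> \<in> V"
    and "\<And>v. v \<in> V \<Longrightarrow> {\<omega> \<in> space M. f \<omega> = v \<and> Q \<omega>} \<in> events"
  shows "prob {\<omega> \<in> space M. Q \<omega>} = (\<Sum>v\<in>V. prob {\<omega> \<in> space M. f \<omega> = v \<and> Q \<omega>})"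
proof -
  have "{\<omega> \<in> space M. Q \<omega>} = (\<Union>v\<in>V. {\<omega> \<in> space M. f \<omega> = v \<and> Q \<omega>})"
    using assms(2) by auto
  also have "prob \<dots> = (\<Sum>v\<in>V. prob {\<omega> \<in> space M. f \<omega> = v \<and> Q \<omega>})"
    using assms by (intro finite_measure_finite_Union) (auto simp: disjoint_family_on_def)
  finally show ?thesis .
qed

end

context prob_space
begin

text \<open>The values \<open>0\<close> and \<open>1\<close> already carry mass \<open>1\<close>, so
  all other weights have probability \<open>0\<close>, like the vanishing higher
  coefficients.\<close>

lemma bernoulli_law:
  assumes "bernoulli_weights M p \<zeta>"
  shows "prob {\<omega> \<in> space M. \<zeta> j \<omega> = i} = coeff [:1 - p, p:] i"
proof -
  have indep: "indep_vars (\<lambda>_. count_space UNIV) \<zeta> UNIV"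
    and law: "prob {\<omega> \<in> space M. \<zeta> j \<omega> = 1} = p" "prob {\<omega> \<in> space M. \<zeta> j \<omega> = 0} = 1 - p"
    using assms by (auto simp: bernoulli_weights_def)
  have [measurable]: "random_variable (count_space UNIV) (\<zeta> j)"
    using indep by (simp add: indep_vars_def)
  consider "i = 0" | "i = 1" | "i \<ge> 2" by linarith
  then show ?thesis
  proof cases
    case 3
    have "prob ({\<omega> \<in> space M. \<zeta> j \<omega> = 1} \<union> {\<omega> \<in> space M. \<zeta> j \<omega> = 0}) = 1"
      using law by (subst finite_measure_Union) auto
    then have "prob ({\<omega> \<in> space M. \<zeta> j \<omega> = 1} \<union> {\<omega> \<in> space M. \<zeta> j \<omega> = 0} \<union> {\<omega> \<in> space M. \<zeta> j \<omega> = i})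
        = 1 + prob {\<omega> \<in> space M. \<zeta> j \<omega> = i}"
      using 3 by (subst finite_measure_Union) auto
    moreover have "prob ({\<omega> \<in> space M. \<zeta> j \<omega> = 1} \<union> {\<omega> \<in> space M. \<zeta> j \<omega> = 0} \<union> {\<omega> \<in> space M. \<zeta> j \<omega> = i}) \<le> 1"
      by (rule prob_le_1)
    ultimately have "prob {\<omega> \<in> space M. \<zeta> j \<omega> = i} = 0"
      using measure_nonneg[of M "{\<omega> \<in> space M. \<zeta> j \<omega> = i}"] by linarith
    then show ?thesis
      using 3 by (simp add: coeff_pCons split: nat.split)
  qed (use law in simp_all)
qed

end

section \<open>Counting the possible block ends\<close>

definition window :: "nat \<Rightarrow> int \<Rightarrow> int set" where
  "window N j = {2 ^ N * j..<2 ^ N * (j + 1)}"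

lemma mem_window_iff: "t \<in> window N j \<longleftrightarrow> t div 2 ^ N = j"
proof
  assume "t div 2 ^ N = j"
  then have "2 ^ N * j + t mod 2 ^ N = t"
    by (metis mult_div_mod_eq)
  moreover have "0 \<le> t mod 2 ^ N" "t mod 2 ^ N < 2 ^ N"
    by simp_all
  ultimately show "t \<in> window N j"
    unfolding window_def distrib_left atLeastLessThan_iff by linarith
next
  assume "t \<in> window N j"
  then have "t - 2 ^ N * j \<in> {0..<2 ^ N}"
    by (auto simp: window_def distrib_left)
  moreover have "(2 ^ N * j + d) div 2 ^ N = j" if "d \<in> {0..<2 ^ N}" for d
    using that by (simp add: div_pos_pos_trivial)
  ultimately have "(2 ^ N * j + (t - 2 ^ N * j)) div 2 ^ N = j"
    by blast
  then show "t div 2 ^ N = j"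
    by simp
qed

text \<open>Measured from the border \<open>b = 2 ^ N * (j + 1)\<close> of the two windows,
  \<open>s = b - 1 - u\<close> and \<open>t = b + v\<close>, so \<open>t - s = 1 + u + v\<close> and
  the sum factors. This is the origin of \<open>F\<close> in the ordered case.\<close>

lemma sum_windows:
  fixes q :: "'a::comm_semiring_1"
  shows "(\<Sum>s\<in>window N j. \<Sum>t\<in>window N (j + 1). q ^ nat (t - s)) = q * (\<Sum>k<2 ^ N. q ^ k)\<^sup>2"
proof -
  let ?m = "2 ^ N :: int"
  have less: "1 + int b \<le> 2 ^ N \<longleftrightarrow> b < 2 ^ N" for b
    using of_nat_less_numeral_power_cancel_iff[where ?'a = int, of b "num.Bit0 num.One" N] by linarith
  have inner: "(\<Sum>t\<in>window N (j + 1). q ^ nat (t - s)) = (\<Sum>v<2 ^ N. q ^ nat (?m * (j + 1) + int v - s))" for s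
    unfolding window_def
    by (rule sum.reindex_bij_witness[of _ "\<lambda>v. ?m * (j + 1) + int v" "\<lambda>t. nat (t - ?m * (j + 1))"])
      (auto simp: algebra_simps nat_less_iff zless_nat_eq_int_zless less)
  have "(\<Sum>s\<in>window N j. \<Sum>v<2 ^ N. q ^ nat (?m * (j + 1) + int v - s))
      = (\<Sum>u<2 ^ N. \<Sum>v<2 ^ N. q ^ nat (?m * (j + 1) + int v - (?m * (j + 1) - 1 - int u)))"
    unfolding window_def
    by (rule sum.reindex_bij_witness[of _ "\<lambda>u. ?m * (j + 1) - 1 - int u" "\<lambda>s. nat (?m * (j + 1) - 1 - s)"])
      (auto simp: algebra_simps nat_less_iff zless_nat_eq_int_zless less)
  also have "\<dots> = (\<Sum>u<2 ^ N. \<Sum>v<2 ^ N. q * (q ^ u * q ^ v))"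
    by (intro sum.cong refl) (simp add: nat_add_distrib power_add mult_ac add.commute)
  also have "\<dots> = q * (\<Sum>k<2 ^ N. q ^ k)\<^sup>2"
    by (simp only: power2_eq_square sum_product) (simp only: sum_distrib_left)
  finally show ?thesis
    by (simp only: inner)
qed

definition ends :: "(nat \<Rightarrow> int \<Rightarrow> bool) \<Rightarrow> nat \<Rightarrow> int \<Rightarrow> int \<times> int" where
  "ends r N j = (boundary r N j, boundary r N (j + 1))"

definition end_windows :: "nat \<Rightarrow> int \<Rightarrow> (int \<times> int) set" where
  "end_windows N j = window N j \<times> window N (j + 1)"

text \<open>Meant as the joint probability of the ends \<open>u\<close> and the weight
  \<open>i\<close>: each end has probability \<open>(1 / 2) ^ N\<close>, and each cell of the block
  contributes a factor \<open>q\<close>.\<close>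

definition block_coeff :: "real poly \<Rightarrow> nat \<Rightarrow> int \<times> int \<Rightarrow> nat \<Rightarrow> real" where
  "block_coeff q N u i = (1 / 4) ^ N * coeff (q ^ nat (snd u - fst u)) i"

lemma ends_mem: "ends r N j \<in> end_windows N j"
  by (simp add: ends_def end_windows_def mem_window_iff boundary_div)

lemma finite_end_windows: "finite (end_windows N j)"
  by (simp add: end_windows_def window_def)

lemma end_windows_nonempty: "end_windows N j \<noteq> {}"
  using ends_mem[of undefined N j] by auto

lemma pcompose_power: "(p ^ n) \<circ>\<^sub>p q = (p \<circ>\<^sub>p q) ^ n"
  by (induction n) (simp_all add: pcompose_mult one_pCons)

lemma coeff_ordered_poly_pcompose:
  "coeff (ordered_poly N \<circ>\<^sub>p q) i = (\<Sum>u\<in>end_windows N j. block_coeff q N u i)"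
proof -
  have "ordered_poly N \<circ>\<^sub>p q = smult ((1 / 4) ^ N) (q * (\<Sum>k<2 ^ N. q ^ k)\<^sup>2)"
    by (simp add: ordered_poly_def pcompose_smult pcompose_mult pcompose_power pcompose_sum pcompose_pCons power_one_over)
  then show ?thesis
    by (simp add: sum_windows[symmetric, where j = j] coeff_sum sum_distrib_left block_coeff_def
        end_windows_def sum.cartesian_product case_prod_beta)
qed

section \<open>One-cell and joint laws after any number of steps\<close>

context prob_space
begin

context
  fixes p :: real and x :: "nat \<Rightarrow> int \<Rightarrow> 'a \<Rightarrow> nat" and r :: "nat \<Rightarrow> int \<Rightarrow> 'a \<Rightarrow> bool"
  assumes bern: "bernoulli_weights M p (x 0)" and fair: "fair_moves M x r"
begin

lemma initial_indep: "indep_vars (\<lambda>_. count_space UNIV) (x 0) UNIV"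
  using bern by (simp add: bernoulli_weights_def)

lemma prob_initial_sum:
  "finite K \<Longrightarrow> prob {\<omega> \<in> space M. (\<Sum>k\<in>K. x 0 k \<omega>) = i} = coeff ([:1 - p, p:] ^ card K) i"
  by (rule prob_sum_eq_coeff[OF initial_indep bernoulli_law[OF bern]])

text \<open>Once the ends are fixed, the weight is a sum of initial weights over a deterministic
  interval, so \<open>boundary_event\<close> applies. For \<open>j + 2 \<le> k\<close> the four ends
  lie in distinct windows and the first block stops before the second starts; neighbouring cells
  would share an end.\<close>

lemma ordered_block_event:
  fixes i i' :: nat
  assumes oc: "ordered_compression M x r" and "j + 2 \<le> k"
    and u: "u \<in> end_windows N j" and u': "u' \<in> end_windows N k"
  defines "E \<equiv> {\<omega> \<in> space M. ends (\<lambda>n j. r n j \<omega>) N j = u \<and> x N j \<omega> = i}"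
    and "E' \<equiv> {\<omega> \<in> space M. ends (\<lambda>n j. r n j \<omega>) N k = u' \<and> x N k \<omega> = i'}"
  shows "E \<in> events" "prob E = block_coeff [:1 - p, p:] N u i"
    "E \<inter> E' \<in> events"
    "prob (E \<inter> E') = block_coeff [:1 - p, p:] N u i * block_coeff [:1 - p, p:] N u' i'"
proof -
  obtain s t s' t' where [simp]: "u = (s, t)" "u' = (s', t')"
    by (metis prod.exhaust)
  have div: "s div 2 ^ N = j" "t div 2 ^ N = j + 1" "s' div 2 ^ N = k" "t' div 2 ^ N = k + 1"
    using u u' by (simp_all add: end_windows_def mem_window_iff)
  let ?bd = "\<lambda>N j \<omega>. boundary (\<lambda>n j. r n j \<omega>) N j"
  have state: "x N j \<omega> = (\<Sum>k\<in>{?bd N j \<omega>..<?bd N (j + 1) \<omega>}. x 0 k \<omega>)" if "\<omega> \<in> space M" for N j \<omega>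
    by (rule ordered_state) (use oc that in \<open>simp add: ordered_compression_def\<close>)
  define A where "A = {\<omega> \<in> space M. (\<Sum>k\<in>{s..<t}. x 0 k \<omega>) = i}"
  define A' where "A' = {\<omega> \<in> space M. (\<Sum>k\<in>{s'..<t'}. x 0 k \<omega>) = i'}"
  define B where "B T = {\<omega> \<in> space M. \<forall>t\<in>T. ?bd N (t div 2 ^ N) \<omega> = t}" for T
  have A: "A \<in> past_events M x r 0" "A' \<in> past_events M x r 0"
    unfolding A_def A'_def by (intro sum_event_in_past; simp)+
  have E: "E = B {s, t} \<inter> A"
    by (auto simp: E_def B_def A_def div state ends_def)
  have E': "E' = B {s', t'} \<inter> A'"
    by (auto simp: E'_def B_def A'_def div state ends_def)
  have BB: "B {s, t} \<inter> B {s', t'} = B {s, t, s', t'}"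
    by (auto simp: B_def)
  have inj: "inj_on (\<lambda>t. t div 2 ^ N) {s, t}" "inj_on (\<lambda>t. t div 2 ^ N) {s, t, s', t'}"
    using div \<open>j + 2 \<le> k\<close> by (auto simp: inj_on_def)
  have "s \<noteq> t" "s \<noteq> s'" "s \<noteq> t'" "t \<noteq> s'" "t \<noteq> t'" "s' \<noteq> t'"
    using div \<open>j + 2 \<le> k\<close> by auto
  then have card: "card {s, t} = 2" "card {s, t, s', t'} = 4"
    by simp_all
  have pow: "((1 / 2) ^ (N * 2) :: real) = (1 / 4) ^ N" "((1 / 2) ^ (N * 4) :: real) = (1 / 4) ^ N * (1 / 4) ^ N"
    by (simp_all add: mult.commute[of N] power_mult power_divide flip: power_mult_distrib)
  have A_prob: "prob A = coeff ([:1 - p, p:] ^ nat (t - s)) i" "prob A' = coeff ([:1 - p, p:] ^ nat (t' - s')) i'"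
    unfolding A_def A'_def by (simp_all add: prob_initial_sum)
  have "B {s, t} \<inter> A \<in> past_events M x r N"
    unfolding B_def by (intro boundary_event(1) fair A inj) simp
  moreover have "prob (B {s, t} \<inter> A) = (1 / 2) ^ (N * card {s, t}) * prob A"
    unfolding B_def by (intro boundary_event(2)[OF fair] A inj) simp
  ultimately show "E \<in> events" "prob E = block_coeff [:1 - p, p:] N u i"
    using past_subset_events[OF fair] unfolding card pow E A_prob by (auto simp: block_coeff_def)
  have AA: "A \<inter> A' \<in> past_events M x r 0"
    using A by (rule past_events_Int)
  have EE: "E \<inter> E' = B {s, t, s', t'} \<inter> (A \<inter> A')"
    unfolding E E' BB[symmetric] by auto
  have "B {s, t, s', t'} \<inter> (A \<inter> A') \<in> past_events M x r N"
    unfolding B_def by (intro boundary_event(1) fair AA inj) simp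
  then show "E \<inter> E' \<in> events"
    using past_subset_events[OF fair] unfolding EE by blast
  have "t < s'"
    using div \<open>j + 2 \<le> k\<close> zdiv_mono1[of s' t "2 ^ N"] by (intro not_le_imp_less notI) simp
  then have "{s..<t} \<inter> {s'..<t'} = {}" by auto
  from prob_disjoint_sums[OF initial_indep this, of i i'] have "prob (A \<inter> A') = prob A * prob A'"
    unfolding A_def A'_def by (simp add: Int_def conj_ac cong: conj_cong)
  moreover have "prob (B {s, t, s', t'} \<inter> (A \<inter> A')) = (1 / 2) ^ (N * card {s, t, s', t'}) * prob (A \<inter> A')"
    unfolding B_def by (intro boundary_event(2)[OF fair] AA inj) simp
  ultimately show "prob (E \<inter> E') = block_coeff [:1 - p, p:] N u i * block_coeff [:1 - p, p:] N u' i'"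
    unfolding EE card pow A_prob by (simp add: block_coeff_def)
qed

lemma ordered_law:
  assumes oc: "ordered_compression M x r"
  shows "prob {\<omega> \<in> space M. x N j \<omega> = i} = coeff (ordered_poly N \<circ>\<^sub>p [:1 - p, p:]) i"
proof -
  \<comment> \<open>Any partner serves: the facts about one cell are drawn from the lemma on two
    cells, with second cell \<open>j + 2\<close>.\<close>
  obtain u' where u': "u' \<in> end_windows N (j + 2)"
    using end_windows_nonempty by blast
  let ?E = "\<lambda>u. {\<omega> \<in> space M. ends (\<lambda>n j. r n j \<omega>) N j = u \<and> x N j \<omega> = i}"
  have "prob {\<omega> \<in> space M. x N j \<omega> = i} = (\<Sum>u\<in>end_windows N j. prob (?E u))"
    by (intro prob_partition finite_end_windows ends_mem ordered_block_event(1)[OF oc order_refl _ u'])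
  also have "\<dots> = (\<Sum>u\<in>end_windows N j. block_coeff [:1 - p, p:] N u i)"
    by (intro sum.cong refl ordered_block_event(2)[OF oc order_refl _ u'])
  finally show ?thesis
    by (simp only: coeff_ordered_poly_pcompose[where j = j])
qed

lemma ordered_joint_law:
  assumes oc: "ordered_compression M x r" and "j + 2 \<le> k"
  shows "prob {\<omega> \<in> space M. x N j \<omega> = i \<and> x N k \<omega> = i'}
    = coeff (ordered_poly N \<circ>\<^sub>p [:1 - p, p:]) i * coeff (ordered_poly N \<circ>\<^sub>p [:1 - p, p:]) i'"
proof -
  let ?ends = "\<lambda>j \<omega>. ends (\<lambda>n j. r n j \<omega>) N j"
  let ?W = "end_windows N j \<times> end_windows N k"
  let ?E = "\<lambda>j i u. {\<omega> \<in> space M. ?ends j \<omega> = u \<and> x N j \<omega> = i}"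
  have EE: "{\<omega> \<in> space M. (?ends j \<omega>, ?ends k \<omega>) = v \<and> x N j \<omega> = i \<and> x N k \<omega> = i'}
      = ?E j i (fst v) \<inter> ?E k i' (snd v)" for v
    by auto
  have "prob {\<omega> \<in> space M. x N j \<omega> = i \<and> x N k \<omega> = i'}
      = (\<Sum>v\<in>?W. prob {\<omega> \<in> space M. (?ends j \<omega>, ?ends k \<omega>) = v \<and> x N j \<omega> = i \<and> x N k \<omega> = i'})"
  proof (rule prob_partition)
    show "{\<omega> \<in> space M. (?ends j \<omega>, ?ends k \<omega>) = v \<and> x N j \<omega> = i \<and> x N k \<omega> = i'} \<in> events"
      if "v \<in> ?W" for v
      unfolding EE using that by (intro ordered_block_event(3)[OF oc \<open>j + 2 \<le> k\<close>]) auto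
  qed (simp_all add: finite_end_windows ends_mem)
  also have "\<dots> = (\<Sum>v\<in>?W. block_coeff [:1 - p, p:] N (fst v) i * block_coeff [:1 - p, p:] N (snd v) i')"
    unfolding EE by (intro sum.cong refl ordered_block_event(4)[OF oc \<open>j + 2 \<le> k\<close>]) auto
  also have "\<dots> = (\<Sum>u\<in>end_windows N j. block_coeff [:1 - p, p:] N u i)
      * (\<Sum>u\<in>end_windows N k. block_coeff [:1 - p, p:] N u i')"
    by (simp add: sum_product sum.cartesian_product case_prod_beta)
  finally show ?thesis
    by (simp only: coeff_ordered_poly_pcompose[symmetric])
qed

lemma ordered_measurable:
  assumes "ordered_compression M x r"
  shows "random_variable (count_space UNIV) (x N j)"
proof -
  have "x N j \<in> measurable M (count_space UNIV)" if "past_events M x r N \<subseteq> events"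
  proof (rule measurableI)
    fix A
    have "x N j -` A \<inter> space M \<in> past_events M x r N"
      unfolding past_events_def by (rule sigma_sets.Basic) (auto simp: generators_def)
    then show "x N j -` A \<inter> space M \<in> events"
      using that by blast
  qed simp
  then show ?thesis
    using past_subset_events[OF fair] by blast
qed

text \<open>According to the moves of its two even neighbours a merged cell collects one, two, two
  or three cells, each case with probability \<open>1 / 4\<close> and independently of the current
  i.i.d. weights. So the generating polynomial \<open>g\<close> becomes
  \<open>(g + 2 * g\<^sup>2 + g ^ 3) / 4\<close>.\<close>

lemma disordered_law:
  assumes dc: "disordered_compression M x r"
  shows "indep_vars (\<lambda>_. count_space UNIV) (x n) UNIV"
    and "prob {\<omega> \<in> space M. x n j \<omega> = i} = coeff (disordered_poly n \<circ>\<^sub>p [:1 - p, p:]) i"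
proof -
  show indep: "indep_vars (\<lambda>_. count_space UNIV) (x n) UNIV" for n
    using dc initial_indep by (cases n) (simp_all add: disordered_compression_def)
  show "prob {\<omega> \<in> space M. x n j \<omega> = i} = coeff (disordered_poly n \<circ>\<^sub>p [:1 - p, p:]) i"
  proof (induction n arbitrary: j i)
    case 0
    then show ?case
      using bernoulli_law[OF bern] by (simp add: disordered_poly_def pcompose_pCons)
  next
    case (Suc n)
    let ?G = "disordered_poly n \<circ>\<^sub>p [:1 - p, p:]"
    define y where "y \<omega> = merge (\<lambda>k. r n k \<omega>) (\<lambda>k. x n k \<omega>) 0" for \<omega>
    \<comment> \<open>\<open>v\<close> records the moves of the even cells \<open>0\<close> and
      \<open>2\<close>, and \<open>K v\<close> the cells that end up in cell
      \<open>1\<close>.\<close>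
    define K :: "bool \<times> bool \<Rightarrow> int set" where
      "K v = {1} \<union> (if fst v then {0} else {}) \<union> (if snd v then {} else {2})" for v
    define c where "c v = (\<lambda>j::int. if j = 0 then fst v else snd v)" for v :: "bool \<times> bool"
    define R where "R v = {\<omega> \<in> space M. \<forall>j\<in>{0, 1}. r n j \<omega> = c v j}" for v
    define S where "S i v = {\<omega> \<in> space M. (\<Sum>k\<in>K v. x n k \<omega>) = i}" for i v
    have RS: "{\<omega> \<in> space M. (r n 0 \<omega>, r n 1 \<omega>) = v \<and> y \<omega> = i} = R v \<inter> S i v" for v i
      by (cases v) (auto simp: R_def S_def y_def merge_def c_def K_def)
    have S: "S i v \<in> past_events M x r n" for i v
      unfolding S_def by (rule sum_event_in_past) simp
    have ev: "R v \<inter> S i v \<in> events" for i v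
    proof -
      have "R v \<in> past_events M x r (Suc n)"
        unfolding R_def by (intro subsetD[OF moves_in_past] move_event_in_sigma) simp
      then show ?thesis
        using subsetD[OF past_subset_events[OF fair]] S by (intro sets.Int) simp_all
    qed
    have pr: "prob (R v \<inter> S i v) = 1 / 4 * coeff (?G ^ card (K v)) i" for i v
    proof -
      have "finite (K v)"
        by (simp add: K_def)
      then have "prob (S i v) = coeff (?G ^ card (K v)) i"
        unfolding S_def by (rule prob_sum_eq_coeff[OF indep Suc.IH])
      then show ?thesis
        unfolding R_def by (subst prob_moves_past[OF fair _ S]) (simp_all add: power2_eq_square)
    qed
    \<comment> \<open>\<open>disordered_compression\<close> compares image measures, and
      \<open>distr\<close> reads as the law of \<open>y\<close> only for measurable
      \<open>y\<close>.\<close>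
    have y_meas: "random_variable (count_space UNIV) y"
    proof (subst measurable_count_space_eq2_countable, safe)
      fix i
      have "y -` {i} \<inter> space M = (\<Union>v\<in>UNIV. R v \<inter> S i v)"
        unfolding RS[symmetric] by auto
      also have "\<dots> \<in> events"
        using ev by (intro sets.finite_UN) simp_all
      finally show "y -` {i} \<inter> space M \<in> events" .
    qed simp_all
    have "prob {\<omega> \<in> space M. x (Suc n) j \<omega> = i} = measure (distr M (count_space UNIV) (x (Suc n) j)) {i}"
      using indep[of "Suc n"] by (subst measure_distr) (auto simp: indep_vars_def vimage_def Int_def conj_commute)
    also have "\<dots> = measure (distr M (count_space UNIV) y) {i}"
      using dc unfolding disordered_compression_def y_def by simp
    also have "\<dots> = prob {\<omega> \<in> space M. y \<omega> = i}"
      using y_meas by (subst measure_distr) (auto simp: vimage_def Int_def conj_commute)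
    also have "\<dots> = (\<Sum>v\<in>UNIV. prob {\<omega> \<in> space M. (r n 0 \<omega>, r n 1 \<omega>) = v \<and> y \<omega> = i})"
      by (rule prob_partition) (simp_all only: RS ev finite UNIV_I)
    also have "\<dots> = (\<Sum>v\<in>UNIV. 1 / 4 * coeff (?G ^ card (K v)) i)"
      unfolding RS pr ..
    also have "\<dots> = 1 / 4 * (coeff ?G i + 2 * coeff (?G\<^sup>2) i + coeff (?G ^ 3) i)"
    proof -
      have moves: "(UNIV :: (bool \<times> bool) set) = {(True, True), (True, False), (False, True), (False, False)}"
        by auto
      have "card (K (True, True)) = 2" "card (K (True, False)) = 3"
        "card (K (False, True)) = 1" "card (K (False, False)) = 2"
        by (simp_all add: K_def)
      then show ?thesis
        unfolding moves by (simp add: algebra_simps)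
    qed
    also have "\<dots> = coeff (disordered_poly (Suc n) \<circ>\<^sub>p [:1 - p, p:]) i"
      by (simp add: disordered_poly_def pcompose_smult pcompose_add pcompose_power)
    finally show ?case .
  qed
qed

end

end

section \<open>Almost sure densities and their ratios\<close>

theorem theorem1p3:
  fixes M :: "'a measure" and p :: real
    and x :: "nat \<Rightarrow> int \<Rightarrow> 'a \<Rightarrow> nat" and r :: "nat \<Rightarrow> int \<Rightarrow> 'a \<Rightarrow> bool"
  assumes "prob_space M"
    and "0 < p" and "p \<le> 1"
    and "bernoulli_weights M p (x 0)"
    and "fair_moves M x r"
  shows
    "(ordered_compression M x r \<longrightarrow>
       (AE \<omega> in M.
         (\<forall>N i. has_cell_density (\<lambda>j. x N j \<omega>) i
                  ((deriv ^^ i) (F_ordered N) (1 - p) * p ^ i / fact i)) \<and>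
         (\<forall>i. (\<lambda>N. cell_density (\<lambda>j. x N j \<omega>) i / cell_density (\<lambda>j. x N j \<omega>) 1)
                \<longlonglongrightarrow> (real i + 1 - p) / (2 - p)))) \<and>
     (disordered_compression M x r \<longrightarrow>
       (AE \<omega> in M.
         (\<forall>N i. has_cell_density (\<lambda>j. x N j \<omega>) i
                  ((deriv ^^ i) (F_disordered N) (1 - p) * p ^ i / fact i)) \<and>
         (\<forall>i. (\<lambda>N. complex_of_real
                       (cell_density (\<lambda>j. x N j \<omega>) i / cell_density (\<lambda>j. x N j \<omega>) 1))
                \<longlonglongrightarrow> (deriv ^^ i) Phi (complex_of_real (1 - p))
                      * complex_of_real (p powi (int i - 1))
                      / (deriv Phi (complex_of_real (1 - p)) * fact i))))"
proof (intro conjI impI)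
  interpret prob_space M by fact
  let ?a = "1 - p"
  have coeff_eq: "coeff (Q \<circ>\<^sub>p [:?a, p:]) i = poly ((pderiv ^^ i) Q) ?a * p ^ i / fact i" for Q i
    by (rule coeff_pcompose_affine)
  \<comment> \<open>\<open>lim\<close> is meaningful only for convergent sequences, so every value
    of \<open>cell_density\<close> is drawn from \<open>has_cell_density\<close>.\<close>
  have density: "cell_density y i = d" if "has_cell_density y i d" for y i d
    using that unfolding has_cell_density_def cell_density_def by (rule limI)
  {
    assume oc: "ordered_compression M x r"
    let ?c = "\<lambda>N i. coeff (ordered_poly N \<circ>\<^sub>p [:?a, p:]) i"
    have "AE \<omega> in M. has_cell_density (\<lambda>j. x N j \<omega>) i (?c N i)" for N i
      by (intro AE_has_cell_density)
        (simp_all add: ordered_measurable[OF assms(4,5) oc] ordered_law[OF assms(4,5) oc]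
          ordered_joint_law[OF assms(4,5) oc] power2_eq_square)
    \<comment> \<open>The pairs of \<open>N\<close> and \<open>i\<close> are countable, so one null
      set serves all; off it the ratios of densities are deterministic.\<close>
    then have "AE \<omega> in M. \<forall>N i. has_cell_density (\<lambda>j. x N j \<omega>) i (?c N i)"
      by (simp add: AE_all_countable)
    then show "AE \<omega> in M.
         (\<forall>N i. has_cell_density (\<lambda>j. x N j \<omega>) i
                  ((deriv ^^ i) (F_ordered N) (1 - p) * p ^ i / fact i)) \<and>
         (\<forall>i. (\<lambda>N. cell_density (\<lambda>j. x N j \<omega>) i / cell_density (\<lambda>j. x N j \<omega>) 1)
                \<longlonglongrightarrow> (real i + 1 - p) / (2 - p))"
    proof eventually_elim
      case (elim \<omega>)
      \<comment> \<open>Here \<open>p > 0\<close> keeps \<open>1 - p\<close> away from the point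
        \<open>1\<close>, where \<open>F_ordered\<close> has its default value.\<close>
      have c: "?c N i = (deriv ^^ i) (F_ordered N) (1 - p) * p ^ i / fact i" for N i
        unfolding coeff_eq using assms by (simp add: higher_deriv_F_ordered)
      have "cell_density (\<lambda>j. x N j \<omega>) i = ?c N i" for N i
        by (intro density) (use elim in blast)
      then show ?case
        using elim tendsto_relative_ordered[OF assms(2,3)] unfolding c[symmetric] by simp
    qed
  next
    assume dc: "disordered_compression M x r"
    let ?c = "\<lambda>N i. coeff (disordered_poly N \<circ>\<^sub>p [:?a, p:]) i"
    have "AE \<omega> in M. has_cell_density (\<lambda>j. x N j \<omega>) i (?c N i)" for N i
    proof (rule AE_has_cell_density)
      note indep = disordered_law(1)[OF assms(4,5) dc]
      show "random_variable (count_space UNIV) (x N j)" for j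
        using indep by (simp add: indep_vars_def)
      show "prob {\<omega> \<in> space M. x N j \<omega> = i \<and> x N k \<omega> = i} = (?c N i)\<^sup>2" if "j + 2 \<le> k" for j k
        using prob_disjoint_sums[OF indep, of "{j}" "{k}" N i i] that
        by (simp add: disordered_law(2)[OF assms(4,5) dc] power2_eq_square)
    qed (rule disordered_law(2)[OF assms(4,5) dc])
    then have "AE \<omega> in M. \<forall>N i. has_cell_density (\<lambda>j. x N j \<omega>) i (?c N i)"
      by (simp add: AE_all_countable)
    then show "AE \<omega> in M.
         (\<forall>N i. has_cell_density (\<lambda>j. x N j \<omega>) i
                  ((deriv ^^ i) (F_disordered N) (1 - p) * p ^ i / fact i)) \<and>
         (\<forall>i. (\<lambda>N. complex_of_real
                       (cell_density (\<lambda>j. x N j \<omega>) i / cell_density (\<lambda>j. x N j \<omega>) 1))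
                \<longlonglongrightarrow> (deriv ^^ i) Phi (complex_of_real (1 - p))
                      * complex_of_real (p powi (int i - 1))
                      / (deriv Phi (complex_of_real (1 - p)) * fact i))"
    proof eventually_elim
      case (elim \<omega>)
      have c: "?c N i = (deriv ^^ i) (F_disordered N) (1 - p) * p ^ i / fact i" for N i
        unfolding coeff_eq by (simp add: F_disordered_eq_poly higher_deriv_poly)
      have d: "cell_density (\<lambda>j. x N j \<omega>) i = ?c N i" for N i
        by (intro density) (use elim in blast)
      have "deriv Phi (complex_of_real (1 - p)) \<noteq> 0"
        using assms by (intro deriv_Phi_nonzero) auto
      then show ?case
        using elim tendsto_relative_coeff[OF uniform_limit_disordered_poly assms(2,3)]
        unfolding c[symmetric] d by blast
    qed
  }
qed

end
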